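(* Let $V=V(\{S_i\}_{i\in I},\{S_j^\omega\}_{j\in J})$ be a Komori variety. Then the theories $\mathbb{L}oc_V^2$ and $\mathbb{G}_{(I,J)}$ are not bi-interpretable, i.e. their geometric syntactic categories are not equivalent.
   Context: The geometric syntactic category $\mathcal{C}_{\mathbb{T}}$ of a geometric theory $\mathbb{T}$ has as objects the geometric formulae-in-context $\{\vec x.\phi\}$ (up to renaming of variables) and as arrows the $\mathbb{T}$-provable-equivalence classes of $\mathbb{T}$-provably functional geometric formulae; an interpretation of $\mathbb{T}$ in $\mathbb{S}$ is a geometric functor $\mathcal{C}_{\mathbb{T}}\to\mathcal{C}_{\mathbb{S}}$. An MV-algebra is a structure $(A,\oplus,\neg,0)$ such that $(A,\oplus,0)$ is a commutative monoid, $\neg\neg x=x$, $x\oplus\neg 0=\neg 0$ and $\neg(\neg x\oplus y)\oplus y=\neg(\neg y\oplus x)\oplus x$. Write $1=\neg 0$, $x\odot y=\neg(\neg x\oplus\neg y)$, $d(x,y)=(x\odot\neg y)\oplus(y\odot\neg x)$, $kx=x\oplus\cdots\oplus x$ and $x^k=x\odot\cdots\odot x$ ($k$ times). $\mathbb{MV}$ is the algebraic theory of MV-algebras. An $\ell$-group is a lattice-ordered abelian group. For an $\ell$-group $G$ and $u\ge 0$ in $G$, $\Gamma(G,u)$ is the MV-algebra on $[0,u]$ with $x\oplus y=\inf(x+y,u)$, $\neg x=u-x$. By Mundici's equivalence every MV-algebra is of this form with $u$ a strong unit. For $m\ge 1$, $S_m=\Gamma(\mathbb{Z},m)$ and $S_m^\omega=\Gamma(\mathbb{Z}\times_{\mathrm{lex}}\mathbb{Z},(m,0))$.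 A Komori variety is a variety $V=V(\{S_i\}_{i\in I},\{S_j^\omega\}_{j\in J})$ generated by these algebras, with $I,J$ finite sets of positive integers, not both empty. Put $n=\mathrm{l.c.m.}(I\cup J)$. $\mathbb{T}_V$ is the algebraic theory axiomatizing $V$: the axioms of $\mathbb{MV}$ plus, with $N=\max(I\cup J)$, the sequents (for all $x$): $((N+1)x^N)^2=2x^{N+1}$; $(px^{p-1})^{N+1}=(N+1)x^p$ for every $1<p<N$ dividing no element of $I\cup J$; $(N+1)x^q=(N+2)x^q$ for every $q$ which divides some $i\in I$ but no $j\in J$; and $((n+1)x^n)^2=2x^{n+1}$. Formulae $x\in\mathrm{Fin}_d^n$ ($0\le d\le n$). $x\in\mathrm{Fin}_0^n$ means $((n+1)x)^2=0$. For $1\le d\le n$ let $D=\gcd(d,n)$ and let $\xi,\chi$ be the unique natural numbers with $0\le\xi\le n/D$, $0\le\chi\le d/D$, $D=\xi d-\chi n$. Let $D_{d,n}^x$ be the MV-term in $x$ whose value in $\Gamma(G,u)$ is $\inf(u,\sup(0,\xi x-\chi u))$, computed in $G$; equivalently it is the $(\chi+1)$-th component of the sum of $\xi$ copies of the sequence $(x,0,0,\dots)$, where the sum $c$ of sequences $a,b$ is given by $c_i=a_i\oplus(a_{i-1}\odot b_1)\oplus\cdots\oplus(a_1\odot b_{i-1})\oplus b_i$. Write $z\equiv w$ for $((n+1)d(z,w))^2=0$. Then $x\in\mathrm{Fin}_d^n$ is the formula $(x\equiv\frac{d}{D}D_{d,n}^x)\wedge\bigwedge_{k=0}^{n/D}\big(\neg(kD_{d,n}^x)\equiv(\frac{n}{D}-k)D_{d,n}^x\big)$.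 $\mathbb{L}oc_V^2$ is the quotient of $\mathbb{T}_V$ obtained by adding $\rho_n:(\top\vdash_x\bigvee_{d=0}^n x\in\mathrm{Fin}_d^n)$ and $(0=1\vdash\bot)$. For a set $K$ of positive integers, $\delta(K)$ is the set of positive divisors of elements of $K$, and $\delta(n)$ the set of positive divisors of $n$. $\mathbb{G}_{(I,J)}$ is the geometric theory whose signature is that of $\ell$-groups together with an additional constant and a $0$-ary relation symbol $R_k$ for each $k\in\delta(n)$, and whose axioms are those of $\ell$-groups (no axiom on the constant) together with (for $k,k'\in\delta(n)$): (1) $(\top\vdash R_1)$; (2) $(R_k\vdash R_{k'})$ whenever $k'$ divides $k$; (3) $(R_k\wedge R_{k'}\vdash R_{\mathrm{l.c.m.}(k,k')})$; (4) $(R_k\vdash_g g=0)$ for every $k\in\delta(I)\setminus\delta(J)$; (5) $(R_k\vdash\bot)$ for every $k\notin\delta(I)\cup\delta(J)$. *)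

theory Defs
  imports Main "HOL-Library.Infinite_Typeclass"
begin

section \<open>Single-sorted geometric logic\<close>

text \<open>
  Variables are de Bruijn indices and a context is the number of its variables, so that a
  formula-in-context is taken up to renaming of free and bound variables. A context
  \<open>n\<close> declares the variables \<open>0, \<dots>, n - 1\<close>; in \<open>Ex \<phi>\<close> the
  variable \<open>0\<close> of \<open>\<phi>\<close> is bound and the variable \<open>i + 1\<close> of
  \<open>\<phi>\<close> denotes the variable \<open>i\<close> outside.
\<close>

datatype 'f tm = Var nat | Fn 'f "'f tm list"

text \<open>
  \<open>Disj A F\<close> is the disjunction of the formulae \<open>F i\<close> for \<open>i \<in> A\<close>,
  where \<open>A\<close> is an arbitrary set of indices from \<open>'i\<close>. No HOL type contains
  disjunctions over all index sets at once, hence the parameter \<open>'i\<close>,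
  to be instantiated with an infinite type. The values
  \<open>F i\<close> for \<open>i \<notin> A\<close> are irrelevant for derivability; well-formedness asks them
  to be formulae too, so that substitution acts on formulae-in-context.
\<close>

datatype ('f, 'r, 'i) fm =
    Eq "'f tm" "'f tm"
  | Rel 'r "'f tm list"
  | Top
  | And "('f, 'r, 'i) fm" "('f, 'r, 'i) fm"
  | Bot
  | Or "('f, 'r, 'i) fm" "('f, 'r, 'i) fm"
  | Disj "'i set" "'i \<Rightarrow> ('f, 'r, 'i) fm"
  | Ex "('f, 'r, 'i) fm"

text \<open>A symbol of arity \<open>None\<close> does not belong to the signature.\<close>

record ('f, 'r) signature =
  fun_arity :: "'f \<Rightarrow> nat option"
  rel_arity :: "'r \<Rightarrow> nat option"

fun tm_in :: "('f, 'r) signature \<Rightarrow> nat \<Rightarrow> 'f tm \<Rightarrow> bool" where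
  "tm_in S n (Var i) \<longleftrightarrow> i < n"
| "tm_in S n (Fn f ts) \<longleftrightarrow> fun_arity S f = Some (length ts) \<and> (\<forall>t\<in>set ts. tm_in S n t)"

primrec fm_in :: "('f, 'r) signature \<Rightarrow> nat \<Rightarrow> ('f, 'r, 'i) fm \<Rightarrow> bool" where
  "fm_in S n (Eq s t) \<longleftrightarrow> tm_in S n s \<and> tm_in S n t"
| "fm_in S n (Rel r ts) \<longleftrightarrow> rel_arity S r = Some (length ts) \<and> (\<forall>t\<in>set ts. tm_in S n t)"
| "fm_in S n Top \<longleftrightarrow> True"
| "fm_in S n (And \<phi> \<psi>) \<longleftrightarrow> fm_in S n \<phi> \<and> fm_in S n \<psi>"
| "fm_in S n Bot \<longleftrightarrow> True"
| "fm_in S n (Or \<phi> \<psi>) \<longleftrightarrow> fm_in S n \<phi> \<and> fm_in S n \<psi>"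
| "fm_in S n (Disj A F) \<longleftrightarrow> (\<forall>i. fm_in S n (F i))"
| "fm_in S n (Ex \<phi>) \<longleftrightarrow> fm_in S (Suc n) \<phi>"

primrec tm_subst :: "(nat \<Rightarrow> 'f tm) \<Rightarrow> 'f tm \<Rightarrow> 'f tm" where
  "tm_subst \<sigma> (Var i) = \<sigma> i"
| "tm_subst \<sigma> (Fn f ts) = Fn f (map (tm_subst \<sigma>) ts)"

definition lift_subst :: "(nat \<Rightarrow> 'f tm) \<Rightarrow> nat \<Rightarrow> 'f tm" where
  "lift_subst \<sigma> = case_nat (Var 0) (\<lambda>i. tm_subst (\<lambda>j. Var (Suc j)) (\<sigma> i))"

primrec subst :: "(nat \<Rightarrow> 'f tm) \<Rightarrow> ('f, 'r, 'i) fm \<Rightarrow> ('f, 'r, 'i) fm" where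
  "subst \<sigma> (Eq s t) = Eq (tm_subst \<sigma> s) (tm_subst \<sigma> t)"
| "subst \<sigma> (Rel r ts) = Rel r (map (tm_subst \<sigma>) ts)"
| "subst \<sigma> Top = Top"
| "subst \<sigma> (And \<phi> \<psi>) = And (subst \<sigma> \<phi>) (subst \<sigma> \<psi>)"
| "subst \<sigma> Bot = Bot"
| "subst \<sigma> (Or \<phi> \<psi>) = Or (subst \<sigma> \<phi>) (subst \<sigma> \<psi>)"
| "subst \<sigma> (Disj A F) = Disj A (\<lambda>i. subst \<sigma> (F i))"
| "subst \<sigma> (Ex \<phi>) = Ex (subst (lift_subst \<sigma>) \<phi>)"

abbreviation shift :: "('f, 'r, 'i) fm \<Rightarrow> ('f, 'r, 'i) fm" where
  "shift \<equiv> subst (\<lambda>i. Var (Suc i))"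

text \<open>A sequent \<open>(n, \<phi>, \<psi>)\<close> stands for \<open>\<phi> \<turnstile> \<psi>\<close> in context \<open>n\<close>.\<close>

record ('f, 'r, 'i) gtheory =
  sig :: "('f, 'r) signature"
  axs :: "(nat \<times> ('f, 'r, 'i) fm \<times> ('f, 'r, 'i) fm) set"

definition wf_gtheory :: "('f, 'r, 'i) gtheory \<Rightarrow> bool" where
  "wf_gtheory T \<longleftrightarrow> (\<forall>(n, \<phi>, \<psi>) \<in> axs T. fm_in (sig T) n \<phi> \<and> fm_in (sig T) n \<psi>)"

text \<open>
  The sequent calculus of geometric logic (Johnstone, Sketches of an Elephant, D1.3.1).
  Contexts may be empty and are never dropped, so that sorts are not assumed to be inhabited.
\<close>

inductive prov ::
    "('f, 'r, 'i) gtheory \<Rightarrow> nat \<Rightarrow> ('f, 'r, 'i) fm \<Rightarrow> ('f, 'r, 'i) fm \<Rightarrow> bool" for T where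
  ax: "(n, \<phi>, \<psi>) \<in> axs T \<Longrightarrow> prov T n \<phi> \<psi>"
| ident: "fm_in (sig T) n \<phi> \<Longrightarrow> prov T n \<phi> \<phi>"
| subst_rule: "prov T n \<phi> \<psi> \<Longrightarrow> \<forall>i<n. tm_in (sig T) m (\<sigma> i) \<Longrightarrow>
    prov T m (subst \<sigma> \<phi>) (subst \<sigma> \<psi>)"
| cut: "prov T n \<phi> \<psi> \<Longrightarrow> prov T n \<psi> \<chi> \<Longrightarrow> prov T n \<phi> \<chi>"
| eq_refl: "i < n \<Longrightarrow> prov T n Top (Eq (Var i) (Var i))"
| eq_leibniz: "i < n \<Longrightarrow> j < n \<Longrightarrow> fm_in (sig T) n \<phi> \<Longrightarrow>
    prov T n (And (Eq (Var i) (Var j)) \<phi>) (subst (Var(i := Var j)) \<phi>)"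
| top_I: "fm_in (sig T) n \<phi> \<Longrightarrow> prov T n \<phi> Top"
| and_E1: "fm_in (sig T) n \<phi> \<Longrightarrow> fm_in (sig T) n \<psi> \<Longrightarrow> prov T n (And \<phi> \<psi>) \<phi>"
| and_E2: "fm_in (sig T) n \<phi> \<Longrightarrow> fm_in (sig T) n \<psi> \<Longrightarrow> prov T n (And \<phi> \<psi>) \<psi>"
| and_I: "prov T n \<phi> \<psi> \<Longrightarrow> prov T n \<phi> \<chi> \<Longrightarrow> prov T n \<phi> (And \<psi> \<chi>)"
| bot_E: "fm_in (sig T) n \<phi> \<Longrightarrow> prov T n Bot \<phi>"
| or_I1: "fm_in (sig T) n \<phi> \<Longrightarrow> fm_in (sig T) n \<psi> \<Longrightarrow> prov T n \<phi> (Or \<phi> \<psi>)"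
| or_I2: "fm_in (sig T) n \<phi> \<Longrightarrow> fm_in (sig T) n \<psi> \<Longrightarrow> prov T n \<psi> (Or \<phi> \<psi>)"
| or_E: "prov T n \<phi> \<chi> \<Longrightarrow> prov T n \<psi> \<chi> \<Longrightarrow> prov T n (Or \<phi> \<psi>) \<chi>"
| disj_I: "fm_in (sig T) n (Disj A F) \<Longrightarrow> i \<in> A \<Longrightarrow> prov T n (F i) (Disj A F)"
| disj_E: "fm_in (sig T) n (Disj A F) \<Longrightarrow> fm_in (sig T) n \<chi> \<Longrightarrow>
    \<forall>i\<in>A. prov T n (F i) \<chi> \<Longrightarrow> prov T n (Disj A F) \<chi>"
| ex_L: "fm_in (sig T) n \<psi> \<Longrightarrow> prov T (Suc n) \<phi> (shift \<psi>) \<Longrightarrow> prov T n (Ex \<phi>) \<psi>"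
| ex_R: "prov T n (Ex \<phi>) \<psi> \<Longrightarrow> prov T (Suc n) \<phi> (shift \<psi>)"
| distr: "fm_in (sig T) n \<phi> \<Longrightarrow> fm_in (sig T) n \<psi> \<Longrightarrow> fm_in (sig T) n \<chi> \<Longrightarrow>
    prov T n (And \<phi> (Or \<psi> \<chi>)) (Or (And \<phi> \<psi>) (And \<phi> \<chi>))"
| distr_inf: "fm_in (sig T) n \<phi> \<Longrightarrow> fm_in (sig T) n (Disj A F) \<Longrightarrow>
    prov T n (And \<phi> (Disj A F)) (Disj A (\<lambda>i. And \<phi> (F i)))"
| frobenius: "fm_in (sig T) n \<phi> \<Longrightarrow> fm_in (sig T) (Suc n) \<psi> \<Longrightarrow>
    prov T n (And \<phi> (Ex \<psi>)) (Ex (And (shift \<phi>) \<psi>))"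

definition prov_equiv ::
    "('f, 'r, 'i) gtheory \<Rightarrow> nat \<Rightarrow> ('f, 'r, 'i) fm \<Rightarrow> ('f, 'r, 'i) fm \<Rightarrow> bool" where
  "prov_equiv T n \<phi> \<psi> \<longleftrightarrow> prov T n \<phi> \<psi> \<and> prov T n \<psi> \<phi>"


section \<open>Categories and equivalence of categories\<close>

text \<open>\<open>Cmp \<C> A B C g f\<close> is the composite of \<open>f : A \<rightarrow> B\<close> and \<open>g : B \<rightarrow> C\<close>;
  different hom-sets need not be disjoint.\<close>

record ('o, 'a) cat =
  Obj :: "'o set"
  Hom :: "'o \<Rightarrow> 'o \<Rightarrow> 'a set"
  Idt :: "'o \<Rightarrow> 'a"
  Cmp :: "'o \<Rightarrow> 'o \<Rightarrow> 'o \<Rightarrow> 'a \<Rightarrow> 'a \<Rightarrow> 'a"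

definition is_category :: "('o, 'a) cat \<Rightarrow> bool" where
  "is_category \<C> \<longleftrightarrow>
    (\<forall>A\<in>Obj \<C>. Idt \<C> A \<in> Hom \<C> A A) \<and>
    (\<forall>A\<in>Obj \<C>. \<forall>B\<in>Obj \<C>. \<forall>C\<in>Obj \<C>. \<forall>f\<in>Hom \<C> A B. \<forall>g\<in>Hom \<C> B C.
      Cmp \<C> A B C g f \<in> Hom \<C> A C) \<and>
    (\<forall>A\<in>Obj \<C>. \<forall>B\<in>Obj \<C>. \<forall>f\<in>Hom \<C> A B.
      Cmp \<C> A A B f (Idt \<C> A) = f \<and> Cmp \<C> A B B (Idt \<C> B) f = f) \<and>
    (\<forall>A\<in>Obj \<C>. \<forall>B\<in>Obj \<C>. \<forall>C\<in>Obj \<C>. \<forall>D\<in>Obj \<C>.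
      \<forall>f\<in>Hom \<C> A B. \<forall>g\<in>Hom \<C> B C. \<forall>h\<in>Hom \<C> C D.
      Cmp \<C> A C D h (Cmp \<C> A B C g f) = Cmp \<C> A B D (Cmp \<C> B C D h g) f)"

definition is_functor ::
    "('o, 'a) cat \<Rightarrow> ('p, 'b) cat \<Rightarrow> ('o \<Rightarrow> 'p) \<Rightarrow> ('o \<Rightarrow> 'o \<Rightarrow> 'a \<Rightarrow> 'b) \<Rightarrow> bool" where
  "is_functor \<C> \<D> Fo Fa \<longleftrightarrow>
    (\<forall>A\<in>Obj \<C>. Fo A \<in> Obj \<D>) \<and>
    (\<forall>A\<in>Obj \<C>. \<forall>B\<in>Obj \<C>. \<forall>f\<in>Hom \<C> A B. Fa A B f \<in> Hom \<D> (Fo A) (Fo B)) \<and>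
    (\<forall>A\<in>Obj \<C>. Fa A A (Idt \<C> A) = Idt \<D> (Fo A)) \<and>
    (\<forall>A\<in>Obj \<C>. \<forall>B\<in>Obj \<C>. \<forall>C\<in>Obj \<C>. \<forall>f\<in>Hom \<C> A B. \<forall>g\<in>Hom \<C> B C.
      Fa A C (Cmp \<C> A B C g f) = Cmp \<D> (Fo A) (Fo B) (Fo C) (Fa B C g) (Fa A B f))"

definition is_iso :: "('o, 'a) cat \<Rightarrow> 'o \<Rightarrow> 'o \<Rightarrow> 'a \<Rightarrow> bool" where
  "is_iso \<C> A B f \<longleftrightarrow> f \<in> Hom \<C> A B \<and>
    (\<exists>g\<in>Hom \<C> B A. Cmp \<C> A B A g f = Idt \<C> A \<and> Cmp \<C> B A B f g = Idt \<C> B)"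

definition is_nat_iso ::
    "('o, 'a) cat \<Rightarrow> ('p, 'b) cat \<Rightarrow> ('o \<Rightarrow> 'p) \<Rightarrow> ('o \<Rightarrow> 'o \<Rightarrow> 'a \<Rightarrow> 'b) \<Rightarrow>
      ('o \<Rightarrow> 'p) \<Rightarrow> ('o \<Rightarrow> 'o \<Rightarrow> 'a \<Rightarrow> 'b) \<Rightarrow> ('o \<Rightarrow> 'b) \<Rightarrow> bool" where
  "is_nat_iso \<C> \<D> Fo Fa Go Ga \<eta> \<longleftrightarrow>
    (\<forall>A\<in>Obj \<C>. is_iso \<D> (Fo A) (Go A) (\<eta> A)) \<and>
    (\<forall>A\<in>Obj \<C>. \<forall>B\<in>Obj \<C>. \<forall>f\<in>Hom \<C> A B.
      Cmp \<D> (Fo A) (Fo B) (Go B) (\<eta> B) (Fa A B f) =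
      Cmp \<D> (Fo A) (Go A) (Go B) (Ga A B f) (\<eta> A))"

definition equivalent_categories :: "('o, 'a) cat \<Rightarrow> ('p, 'b) cat \<Rightarrow> bool" where
  "equivalent_categories \<C> \<D> \<longleftrightarrow> (\<exists>Fo Fa Go Ga \<eta> \<epsilon>.
    is_functor \<C> \<D> Fo Fa \<and> is_functor \<D> \<C> Go Ga \<and>
    is_nat_iso \<C> \<C> (\<lambda>A. A) (\<lambda>A B f. f)
      (\<lambda>A. Go (Fo A)) (\<lambda>A B f. Ga (Fo A) (Fo B) (Fa A B f)) \<eta> \<and>
    is_nat_iso \<D> \<D> (\<lambda>A. Fo (Go A)) (\<lambda>A B f. Fa (Go A) (Go B) (Ga A B f))
      (\<lambda>A. A) (\<lambda>A B f. f) \<epsilon>)"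


section \<open>The geometric syntactic category\<close>

definition vars :: "nat \<Rightarrow> nat \<Rightarrow> 'f tm list" where
  "vars k n = map Var [k..<k + n]"

text \<open>\<open>inst ts \<phi>\<close> is meant for \<open>\<phi>\<close> in context \<open>length ts\<close>.\<close>

definition inst :: "'f tm list \<Rightarrow> ('f, 'r, 'i) fm \<Rightarrow> ('f, 'r, 'i) fm" where
  "inst ts = subst (\<lambda>i. if i < length ts then ts ! i else Var i)"

definition Exs :: "nat \<Rightarrow> ('f, 'r, 'i) fm \<Rightarrow> ('f, 'r, 'i) fm" where
  "Exs m \<phi> = (Ex ^^ m) \<phi>"

definition Ands :: "('f, 'r, 'i) fm list \<Rightarrow> ('f, 'r, 'i) fm" where
  "Ands \<phi>s = foldr And \<phi>s Top"

definition Ors :: "('f, 'r, 'i) fm list \<Rightarrow> ('f, 'r, 'i) fm" where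
  "Ors \<phi>s = foldr Or \<phi>s Bot"

definition Eqs :: "'f tm list \<Rightarrow> 'f tm list \<Rightarrow> ('f, 'r, 'i) fm" where
  "Eqs ss ts = Ands (map2 Eq ss ts)"

text \<open>
  For \<open>\<phi>(x)\<close> in context \<open>n\<close> and \<open>\<psi>(y)\<close> in context \<open>m\<close>, a formula
  \<open>\<theta>(x, y)\<close> from \<open>\<phi>\<close> to \<open>\<psi>\<close> lives in context \<open>n + m\<close>,
  where \<open>x\<close> are the first \<open>n\<close> variables and \<open>y\<close> the last \<open>m\<close> ones.
  Under \<open>Exs m\<close> the bound variables are \<open>0, \<dots>, m - 1\<close>, and those of the
  surrounding context start at \<open>m\<close>.
\<close>

definition prov_functional ::
    "('f, 'r, 'i) gtheory \<Rightarrow> nat \<times> ('f, 'r, 'i) fm \<Rightarrow> nat \<times> ('f, 'r, 'i) fm \<Rightarrow>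
      ('f, 'r, 'i) fm \<Rightarrow> bool" where
  "prov_functional T = (\<lambda>(n, \<phi>) (m, \<psi>) \<theta>.
    fm_in (sig T) (n + m) \<theta> \<and>
    prov T (n + m) \<theta> (And (inst (vars 0 n) \<phi>) (inst (vars n m) \<psi>)) \<and>
    prov T n \<phi> (Exs m (inst (vars m n @ vars 0 m) \<theta>)) \<and>
    prov T (n + m + m)
      (And (inst (vars 0 n @ vars n m) \<theta>) (inst (vars 0 n @ vars (n + m) m) \<theta>))
      (Eqs (vars n m) (vars (n + m) m)))"

definition prov_class ::
    "('f, 'r, 'i) gtheory \<Rightarrow> nat \<Rightarrow> ('f, 'r, 'i) fm \<Rightarrow> ('f, 'r, 'i) fm set" where
  "prov_class T n \<theta> = {\<theta>'. prov_equiv T n \<theta> \<theta>'}"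

definition id_fm :: "nat \<Rightarrow> ('f, 'r, 'i) fm \<Rightarrow> ('f, 'r, 'i) fm" where
  "id_fm n \<phi> = And (inst (vars 0 n) \<phi>) (Eqs (vars 0 n) (vars n n))"

text \<open>The composite of \<open>\<theta>(x, y)\<close> and \<open>\<gamma>(y, z)\<close> is \<open>\<exists>y. \<theta>(x, y) \<and> \<gamma>(y, z)\<close>.\<close>

definition comp_fm ::
    "nat \<Rightarrow> nat \<Rightarrow> nat \<Rightarrow> ('f, 'r, 'i) fm \<Rightarrow> ('f, 'r, 'i) fm \<Rightarrow> ('f, 'r, 'i) fm" where
  "comp_fm n m p \<gamma> \<theta> =
    Exs m (And (inst (vars m n @ vars 0 m) \<theta>) (inst (vars 0 m @ vars (m + n) p) \<gamma>))"

definition syntactic_category ::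
    "('f, 'r, 'i) gtheory \<Rightarrow> (nat \<times> ('f, 'r, 'i) fm, ('f, 'r, 'i) fm set) cat" where
  "syntactic_category T =
    \<lparr>Obj = {(n, \<phi>). fm_in (sig T) n \<phi>},
     Hom = (\<lambda>A B. {prov_class T (fst A + fst B) \<theta> | \<theta>. prov_functional T A B \<theta>}),
     Idt = (\<lambda>A. prov_class T (fst A + fst A) (id_fm (fst A) (snd A))),
     Cmp = (\<lambda>A B C g f. \<Union>\<theta>\<in>f. \<Union>\<gamma>\<in>g.
       prov_class T (fst A + fst C) (comp_fm (fst A) (fst B) (fst C) \<gamma> \<theta>))\<rparr>"

definition bi_interpretable ::
    "('f, 'r, 'i) gtheory \<Rightarrow> ('g, 's, 'i) gtheory \<Rightarrow> bool" where
  "bi_interpretable T S \<longleftrightarrow>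
    equivalent_categories (syntactic_category T) (syntactic_category S)"


section \<open>The theory of a Komori variety and its quotient \<open>\<bbbL>oc\<close>\<close>

datatype mv_fun = MV_Oplus | MV_Neg | MV_Zero

text \<open>There are no relation symbols; \<open>unit\<close> only fills the type parameter.\<close>

definition mv_sig :: "(mv_fun, unit) signature" where
  "mv_sig =
    \<lparr>fun_arity = (\<lambda>f. case f of MV_Oplus \<Rightarrow> Some 2 | MV_Neg \<Rightarrow> Some 1 | MV_Zero \<Rightarrow> Some 0),
     rel_arity = (\<lambda>_. None)\<rparr>"

abbreviation mv_zero :: "mv_fun tm" where "mv_zero \<equiv> Fn MV_Zero []"
abbreviation mv_neg :: "mv_fun tm \<Rightarrow> mv_fun tm" where "mv_neg s \<equiv> Fn MV_Neg [s]"
abbreviation mv_oplus :: "mv_fun tm \<Rightarrow> mv_fun tm \<Rightarrow> mv_fun tm" where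
  "mv_oplus s t \<equiv> Fn MV_Oplus [s, t]"

definition mv_one :: "mv_fun tm" where "mv_one = mv_neg mv_zero"

definition mv_odot :: "mv_fun tm \<Rightarrow> mv_fun tm \<Rightarrow> mv_fun tm" where
  "mv_odot s t = mv_neg (mv_oplus (mv_neg s) (mv_neg t))"

definition mv_dist :: "mv_fun tm \<Rightarrow> mv_fun tm \<Rightarrow> mv_fun tm" where
  "mv_dist s t = mv_oplus (mv_odot s (mv_neg t)) (mv_odot t (mv_neg s))"

primrec mv_mult :: "nat \<Rightarrow> mv_fun tm \<Rightarrow> mv_fun tm" where
  "mv_mult 0 t = mv_zero"
| "mv_mult (Suc k) t = mv_oplus t (mv_mult k t)"

primrec mv_pow :: "mv_fun tm \<Rightarrow> nat \<Rightarrow> mv_fun tm" where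
  "mv_pow t 0 = mv_one"
| "mv_pow t (Suc k) = mv_odot t (mv_pow t k)"

abbreviation mv_eq_ax ::
    "nat \<Rightarrow> mv_fun tm \<Rightarrow> mv_fun tm \<Rightarrow> nat \<times> (mv_fun, unit, 'i) fm \<times> (mv_fun, unit, 'i) fm"
  where "mv_eq_ax n s t \<equiv> (n, Top, Eq s t)"

definition mv_axioms :: "(nat \<times> (mv_fun, unit, 'i) fm \<times> (mv_fun, unit, 'i) fm) set" where
  "mv_axioms = (let x = Var 0; y = Var 1; z = Var 2 in
    {mv_eq_ax 3 (mv_oplus x (mv_oplus y z)) (mv_oplus (mv_oplus x y) z),
     mv_eq_ax 2 (mv_oplus x y) (mv_oplus y x),
     mv_eq_ax 1 (mv_oplus x mv_zero) x,
     mv_eq_ax 1 (mv_neg (mv_neg x)) x,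
     mv_eq_ax 1 (mv_oplus x (mv_neg mv_zero)) (mv_neg mv_zero),
     mv_eq_ax 2 (mv_oplus (mv_neg (mv_oplus (mv_neg x) y)) y)
                (mv_oplus (mv_neg (mv_oplus (mv_neg y) x)) x)})"

definition delta :: "nat set \<Rightarrow> nat set" where
  "delta K = {k. 0 < k \<and> (\<exists>i\<in>K. k dvd i)}"

text \<open>
  The variety generated by the \<open>S\<^sub>i\<close>, \<open>i \<in> I\<close>, and the
  \<open>S\<^sub>j\<^sup>\<omega>\<close>, \<open>j \<in> J\<close>, enters only through the pair \<open>(I, J)\<close>.
\<close>

definition komori_index :: "nat set \<Rightarrow> nat set \<Rightarrow> bool" where
  "komori_index I J \<longleftrightarrow> finite I \<and> finite J \<and> I \<union> J \<noteq> {} \<and> 0 \<notin> I \<union> J"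

definition komori_axioms ::
    "nat set \<Rightarrow> nat set \<Rightarrow> (nat \<times> (mv_fun, unit, 'i) fm \<times> (mv_fun, unit, 'i) fm) set" where
  "komori_axioms I J = (let N = Max (I \<union> J); n = Lcm (I \<union> J); x = Var 0 in
    {mv_eq_ax 1 (mv_pow (mv_mult (N + 1) (mv_pow x N)) 2) (mv_mult 2 (mv_pow x (N + 1)))} \<union>
    {mv_eq_ax 1 (mv_pow (mv_mult p (mv_pow x (p - 1))) (N + 1)) (mv_mult (N + 1) (mv_pow x p)) | p.
       1 < p \<and> p < N \<and> p \<notin> delta (I \<union> J)} \<union>
    {mv_eq_ax 1 (mv_mult (N + 1) (mv_pow x q)) (mv_mult (N + 2) (mv_pow x q)) | q.
       q \<in> delta I - delta J} \<union>
    {mv_eq_ax 1 (mv_pow (mv_mult (n + 1) (mv_pow x n)) 2) (mv_mult 2 (mv_pow x (n + 1)))})"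

definition T_V :: "nat set \<Rightarrow> nat set \<Rightarrow> (mv_fun, unit, 'i) gtheory" where
  "T_V I J = \<lparr>sig = mv_sig, axs = mv_axioms \<union> komori_axioms I J\<rparr>"

text \<open>The pair \<open>(\<xi>, \<chi>)\<close>; the defining equation \<open>D = \<xi> d - \<chi> n\<close> is stated
  without subtraction.\<close>

definition is_bezout :: "nat \<Rightarrow> nat \<Rightarrow> nat \<times> nat \<Rightarrow> bool" where
  "is_bezout d n = (\<lambda>(\<xi>, \<chi>). \<xi> \<le> n div gcd d n \<and> \<chi> \<le> d div gcd d n \<and>
    \<xi> * d = gcd d n + \<chi> * n)"

definition bezout_pair :: "nat \<Rightarrow> nat \<Rightarrow> nat \<times> nat" where
  "bezout_pair d n = (THE p. is_bezout d n p)"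

text \<open>Sequences of terms are indexed from \<open>1\<close>; the entry at \<open>0\<close> is junk.\<close>

definition seq_sum :: "(nat \<Rightarrow> mv_fun tm) \<Rightarrow> (nat \<Rightarrow> mv_fun tm) \<Rightarrow> nat \<Rightarrow> mv_fun tm" where
  "seq_sum a b i =
    foldl mv_oplus (a i) (map (\<lambda>j. mv_odot (a (i - j)) (b j)) [1..<i] @ [b i])"

primrec seq_copies :: "nat \<Rightarrow> (nat \<Rightarrow> mv_fun tm) \<Rightarrow> nat \<Rightarrow> mv_fun tm" where
  "seq_copies 0 a = (\<lambda>i. mv_zero)"
| "seq_copies (Suc k) a = seq_sum a (seq_copies k a)"

definition D_tm :: "nat \<Rightarrow> nat \<Rightarrow> mv_fun tm \<Rightarrow> mv_fun tm" where
  "D_tm d n t = (case bezout_pair d n of (\<xi>, \<chi>) \<Rightarrow>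
    seq_copies \<xi> (\<lambda>i. if i = 1 then t else mv_zero) (\<chi> + 1))"

definition mod_rad :: "nat \<Rightarrow> mv_fun tm \<Rightarrow> mv_fun tm \<Rightarrow> (mv_fun, unit, 'i) fm" where
  "mod_rad n z w = Eq (mv_pow (mv_mult (n + 1) (mv_dist z w)) 2) mv_zero"

definition Fin_fm :: "nat \<Rightarrow> nat \<Rightarrow> mv_fun tm \<Rightarrow> (mv_fun, unit, 'i) fm" where
  "Fin_fm n d t =
    (if d = 0 then Eq (mv_pow (mv_mult (n + 1) t) 2) mv_zero
     else let D = gcd d n in
       And (mod_rad n t (mv_mult (d div D) (D_tm d n t)))
         (Ands (map (\<lambda>k. mod_rad n (mv_neg (mv_mult k (D_tm d n t)))
            (mv_mult (n div D - k) (D_tm d n t))) [0..<n div D + 1])))"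

definition Loc2 :: "nat set \<Rightarrow> nat set \<Rightarrow> (mv_fun, unit, 'i) gtheory" where
  "Loc2 I J = (let n = Lcm (I \<union> J) in
    (T_V I J) \<lparr>axs := axs (T_V I J) \<union>
       {(1, Top, Ors (map (\<lambda>d. Fin_fm n d (Var 0)) [0..<n + 1])),
        (0, Eq mv_zero mv_one, Bot)}\<rparr>)"


section \<open>The theory \<open>\<bbbG>\<close>\<close>

datatype lg_fun = LG_Plus | LG_Minus | LG_Zero | LG_Inf | LG_Sup | LG_Const

text \<open>\<open>LG_Minus\<close> is the unary inverse, \<open>LG_Const\<close> the additional constant, and
  the relation symbol \<open>R\<^sub>k\<close> is the number \<open>k\<close>.\<close>

definition G_sig :: "nat \<Rightarrow> (lg_fun, nat) signature" where
  "G_sig n =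
    \<lparr>fun_arity = (\<lambda>f. case f of LG_Plus \<Rightarrow> Some 2 | LG_Minus \<Rightarrow> Some 1 | LG_Zero \<Rightarrow> Some 0
        | LG_Inf \<Rightarrow> Some 2 | LG_Sup \<Rightarrow> Some 2 | LG_Const \<Rightarrow> Some 0),
     rel_arity = (\<lambda>k. if k \<in> delta {n} then Some 0 else None)\<rparr>"

abbreviation lg_plus :: "lg_fun tm \<Rightarrow> lg_fun tm \<Rightarrow> lg_fun tm" where
  "lg_plus s t \<equiv> Fn LG_Plus [s, t]"
abbreviation lg_minus :: "lg_fun tm \<Rightarrow> lg_fun tm" where "lg_minus s \<equiv> Fn LG_Minus [s]"
abbreviation lg_zero :: "lg_fun tm" where "lg_zero \<equiv> Fn LG_Zero []"
abbreviation lg_inf :: "lg_fun tm \<Rightarrow> lg_fun tm \<Rightarrow> lg_fun tm" where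
  "lg_inf s t \<equiv> Fn LG_Inf [s, t]"
abbreviation lg_sup :: "lg_fun tm \<Rightarrow> lg_fun tm \<Rightarrow> lg_fun tm" where
  "lg_sup s t \<equiv> Fn LG_Sup [s, t]"

abbreviation lg_eq_ax ::
    "nat \<Rightarrow> lg_fun tm \<Rightarrow> lg_fun tm \<Rightarrow> nat \<times> (lg_fun, nat, 'i) fm \<times> (lg_fun, nat, 'i) fm"
  where "lg_eq_ax n s t \<equiv> (n, Top, Eq s t)"

text \<open>The order of the \<open>\<ell>\<close>-group is the lattice order.\<close>

definition lgroup_axioms :: "(nat \<times> (lg_fun, nat, 'i) fm \<times> (lg_fun, nat, 'i) fm) set" where
  "lgroup_axioms = (let x = Var 0; y = Var 1; z = Var 2 in
    {lg_eq_ax 3 (lg_plus x (lg_plus y z)) (lg_plus (lg_plus x y) z),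
     lg_eq_ax 2 (lg_plus x y) (lg_plus y x),
     lg_eq_ax 1 (lg_plus x lg_zero) x,
     lg_eq_ax 1 (lg_plus x (lg_minus x)) lg_zero,
     lg_eq_ax 3 (lg_inf x (lg_inf y z)) (lg_inf (lg_inf x y) z),
     lg_eq_ax 2 (lg_inf x y) (lg_inf y x),
     lg_eq_ax 3 (lg_sup x (lg_sup y z)) (lg_sup (lg_sup x y) z),
     lg_eq_ax 2 (lg_sup x y) (lg_sup y x),
     lg_eq_ax 2 (lg_inf x (lg_sup x y)) x,
     lg_eq_ax 2 (lg_sup x (lg_inf x y)) x,
     lg_eq_ax 3 (lg_plus x (lg_inf y z)) (lg_inf (lg_plus x y) (lg_plus x z)),
     lg_eq_ax 3 (lg_plus x (lg_sup y z)) (lg_sup (lg_plus x y) (lg_plus x z))})"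

definition rank_axioms ::
    "nat set \<Rightarrow> nat set \<Rightarrow> (nat \<times> (lg_fun, nat, 'i) fm \<times> (lg_fun, nat, 'i) fm) set" where
  "rank_axioms I J = (let n = Lcm (I \<union> J); R = (\<lambda>k. Rel k []) in
    {(0, Top, R 1)} \<union>
    {(0, R k, R k') | k k'. k \<in> delta {n} \<and> k' \<in> delta {n} \<and> k' dvd k} \<union>
    {(0, And (R k) (R k'), R (lcm k k')) | k k'. k \<in> delta {n} \<and> k' \<in> delta {n}} \<union>
    {(1, R k, Eq (Var 0) lg_zero) | k. k \<in> delta I - delta J} \<union>
    {(0, R k, Bot) | k. k \<in> delta {n} \<and> k \<notin> delta I \<union> delta J})"

definition G_IJ :: "nat set \<Rightarrow> nat set \<Rightarrow> (lg_fun, nat, 'i) gtheory" where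
  "G_IJ I J = \<lparr>sig = G_sig (Lcm (I \<union> J)), axs = lgroup_axioms \<union> rank_axioms I J\<rparr>"


section \<open>Well-formedness\<close>

lemma fm_in_Ands [simp]: "fm_in S k (Ands \<phi>s) \<longleftrightarrow> (\<forall>\<phi>\<in>set \<phi>s. fm_in S k \<phi>)"
  by (induction \<phi>s) (auto simp: Ands_def)

lemma fm_in_Ors [simp]: "fm_in S k (Ors \<phi>s) \<longleftrightarrow> (\<forall>\<phi>\<in>set \<phi>s. fm_in S k \<phi>)"
  by (induction \<phi>s) (auto simp: Ors_def)

lemma mv_arity [simp]: "fun_arity mv_sig MV_Oplus = Some 2" "fun_arity mv_sig MV_Neg = Some 1"
  "fun_arity mv_sig MV_Zero = Some 0"
  by (simp_all add: mv_sig_def)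

lemma mv_in [simp]:
  "tm_in mv_sig n mv_one"
  "tm_in mv_sig n (mv_odot s t) \<longleftrightarrow> tm_in mv_sig n s \<and> tm_in mv_sig n t"
  "tm_in mv_sig n (mv_dist s t) \<longleftrightarrow> tm_in mv_sig n s \<and> tm_in mv_sig n t"
  by (auto simp: mv_one_def mv_odot_def mv_dist_def)

lemma mv_mult_in: "tm_in mv_sig n t \<Longrightarrow> tm_in mv_sig n (mv_mult k t)"
  by (induction k) simp_all

lemma mv_pow_in: "tm_in mv_sig n t \<Longrightarrow> tm_in mv_sig n (mv_pow t k)"
  by (induction k) simp_all

lemma seq_sum_in: "(\<And>i. tm_in mv_sig n (a i)) \<Longrightarrow> (\<And>i. tm_in mv_sig n (b i)) \<Longrightarrow> tm_in mv_sig n (seq_sum a b i)"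
proof -
  assume ab: "\<And>i. tm_in mv_sig n (a i)" "\<And>i. tm_in mv_sig n (b i)"
  have "tm_in mv_sig n s \<Longrightarrow> \<forall>t\<in>set ts. tm_in mv_sig n t \<Longrightarrow> tm_in mv_sig n (foldl mv_oplus s ts)" for s ts
    by (induction ts arbitrary: s) simp_all
  then show ?thesis using ab unfolding seq_sum_def by simp
qed

lemma seq_copies_in: "(\<And>i. tm_in mv_sig n (a i)) \<Longrightarrow> tm_in mv_sig n (seq_copies k a i)"
  by (induction k arbitrary: i) (simp_all add: seq_sum_in)

lemma D_tm_in: "tm_in mv_sig n t \<Longrightarrow> tm_in mv_sig n (D_tm d m t)"
  by (auto simp: D_tm_def split: prod.split intro!: seq_copies_in)

lemma Fin_fm_in: "tm_in mv_sig n t \<Longrightarrow> fm_in mv_sig n (Fin_fm m d t)"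
  by (auto simp: Fin_fm_def Let_def mod_rad_def fm_in_Ands intro!: mv_pow_in mv_mult_in D_tm_in)

lemma wf_Loc2: "wf_gtheory (Loc2 I J)"
proof -
  have v: "tm_in mv_sig 1 (Var 0)" by simp
  show ?thesis unfolding wf_gtheory_def Loc2_def T_V_def mv_axioms_def komori_axioms_def Let_def
    using v by (auto simp del: mv_mult.simps mv_pow.simps simp: fm_in_Ors intro!: mv_pow_in mv_mult_in Fin_fm_in)
qed

lemma delta_subset: "k \<in> delta K \<Longrightarrow> k \<in> delta {Lcm K}"
  by (auto simp: delta_def intro: dvd_trans)

lemma wf_G: assumes "komori_index I J" shows "wf_gtheory (G_IJ I J)"
proof -
  let ?n = "Lcm (I \<union> J)"
  have n: "?n \<noteq> 0" using assms by (auto simp: komori_index_def Lcm_0_iff)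
  have l: "lcm k k' \<in> delta {?n}" if "k \<in> delta {?n}" "k' \<in> delta {?n}" for k k'
    using that by (auto simp: delta_def lcm_pos_nat)
  have d: "k \<in> delta {?n}" if "k \<in> delta I" for k
    using delta_subset[of k "I \<union> J"] that by (auto simp: delta_def)
  have 1: "1 \<in> delta {?n}" using n by (simp add: delta_def)
  show ?thesis
    unfolding wf_gtheory_def G_IJ_def lgroup_axioms_def rank_axioms_def Let_def
    using l d 1 by (auto simp: G_sig_def)
qed

lemma bezout_pair_ex1:
  assumes "1 \<le> d" "d \<le> n"
  shows "\<exists>!p. is_bezout d n p"
proof -
  define D where "D = gcd d n"
  have D: "D > 0" using assms by (simp add: D_def)
  obtain a b where ab: "d = D * a" "n = D * b" unfolding D_def by (meson gcd_dvd1 gcd_dvd2 dvdE)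
  have pos: "a > 0" "b > 0" using ab assms by (auto intro!: Nat.gr0I)
  have ab_div: "n div D = b" "d div D = a" using ab D by simp_all
  have cop: "coprime a b"
    using div_gcd_coprime[of d n] assms ab_div by (simp add: D_def)
  have le: "a \<le> b" using assms(2) D unfolding ab by simp
  have bez: "is_bezout d n (x, y) \<longleftrightarrow> x \<le> b \<and> y \<le> a \<and> x * a = 1 + y * b" for x y
  proof -
    have "x * d = D + y * n \<longleftrightarrow> D * (x * a) = D * (1 + y * b)"
      unfolding ab by (simp add: algebra_simps)
    also have "\<dots> \<longleftrightarrow> x * a = 1 + y * b" using D by (subst mult_cancel1) simp
    finally show ?thesis by (simp add: is_bezout_def ab_div flip: D_def)
  qed
  have "\<exists>x y. is_bezout d n (x, y)"
  proof (cases "b = 1")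
    case True
    then have "is_bezout d n (1, 0)" using le pos by (simp add: bez)
    then show ?thesis by blast
  next
    case False
    then have b: "b > 1" using pos by simp
    obtain x y where "a * x = b * y + 1" using bezout_nat[of a b] pos cop by auto
    then have "(a * x) mod b = 1" using b by (metis add.commute mod_less mod_mult_self2)
    then have "(x mod b * a) mod b = 1" by (simp add: mod_simps mult.commute)
    then have e: "x mod b * a = 1 + (x mod b * a div b) * b"
      by (metis add.commute div_mult_mod_eq)
    have "x mod b * a div b \<le> a"
      using pos by (metis div_le_mono div_mult_self1_is_m less_imp_le mod_less_divisor mult_le_mono1)
    then have "is_bezout d n (x mod b, x mod b * a div b)"
      using e pos by (simp add: bez less_imp_le)
    then show ?thesis by blast
  qed
  moreover have "p = q" if "is_bezout d n p" "is_bezout d n q" for p q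
  proof -
    obtain x y x' y' where [simp]: "p = (x, y)" "q = (x', y')" by (cases p, cases q)
    have h: "x \<le> b" "x' \<le> b" "x * a = 1 + y * b" "x' * a = 1 + y' * b"
      using that by (auto simp: bez)
    then have x0: "0 < x" "0 < x'" by (auto intro!: Nat.gr0I)
    have "int x * int a = 1 + int y * int b" "int x' * int a = 1 + int y' * int b"
      using h by (metis of_nat_1 of_nat_add of_nat_mult)+
    then have "(int x - int x') * int a = (int y - int y') * int b"
      by (simp add: algebra_simps)
    then have "int b dvd (int x - int x') * int a" by simp
    then have "int b dvd int x - int x'"
      using cop by (simp add: coprime_dvd_mult_left_iff coprime_commute)
    moreover have "\<bar>int x - int x'\<bar> < int b" using h x0 by linarith
    ultimately have "x = x'" using zdvd_not_zless[of "\<bar>int x - int x'\<bar>" "int b"] by fastforce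
    then show ?thesis using h pos by simp
  qed
  ultimately show ?thesis by blast
qed


section \<open>The syntactic category is a category\<close>

lemma tm_subst_cong: "tm_in S n t \<Longrightarrow> (\<And>i. i < n \<Longrightarrow> \<sigma> i = \<tau> i) \<Longrightarrow> tm_subst \<sigma> t = tm_subst \<tau> t"
  by (induction t) auto

lemma tm_subst_comp: "tm_subst \<sigma> (tm_subst \<tau> t) = tm_subst (\<lambda>i. tm_subst \<sigma> (\<tau> i)) t"
  by (induction t) auto

lemma tm_subst_Var: "tm_subst Var t = t"
  by (induction t) (auto simp: map_idI)

lemma lift_subst_simps [simp]: "lift_subst \<sigma> 0 = Var 0"
  "lift_subst \<sigma> (Suc i) = tm_subst (\<lambda>j. Var (Suc j)) (\<sigma> i)"
  by (simp_all add: lift_subst_def)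

lemma lift_subst_comp: "tm_subst (lift_subst \<sigma>) (lift_subst \<tau> i) = lift_subst (\<lambda>i. tm_subst \<sigma> (\<tau> i)) i"
  by (cases i) (simp_all add: tm_subst_comp)

lemma subst_comp: "subst \<sigma> (subst \<tau> \<phi>) = subst (\<lambda>i. tm_subst \<sigma> (\<tau> i)) \<phi>"
proof (induction \<phi> arbitrary: \<sigma> \<tau>)
  case (Ex \<phi>)
  then show ?case by (simp add: lift_subst_comp)
qed (auto simp: tm_subst_comp)



lemma subst_cong: "fm_in S n \<phi> \<Longrightarrow> (\<And>i. i < n \<Longrightarrow> \<sigma> i = \<tau> i) \<Longrightarrow> subst \<sigma> \<phi> = subst \<tau> \<phi>"
proof (induction \<phi> arbitrary: \<sigma> \<tau> n)
  case (Eq x1 x2) then show ?case by (auto intro: tm_subst_cong)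
next
  case (Rel x1 x2) then show ?case by (auto intro: tm_subst_cong)
next
  case (And \<phi>1 \<phi>2)
  show ?case using And.IH[of n \<sigma> \<tau>] And.prems by simp
next
  case (Or \<phi>1 \<phi>2)
  show ?case using Or.IH[of n \<sigma> \<tau>] Or.prems by simp
next
  case (Disj A F)
  have "subst \<sigma> (F i) = subst \<tau> (F i)" for i
    using Disj.IH[of "F i" n \<sigma> \<tau>] Disj.prems by simp
  then show ?case by simp
next
  case (Ex \<phi>)
  have "subst (lift_subst \<sigma>) \<phi> = subst (lift_subst \<tau>) \<phi>"
  proof (rule Ex.IH)
    show "fm_in S (Suc n) \<phi>" using Ex.prems by simp
    fix i assume "i < Suc n" then show "lift_subst \<sigma> i = lift_subst \<tau> i"
      using Ex.prems(2) by (cases i) auto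
  qed
  then show ?case by simp
qed auto

lemma lift_Var: "lift_subst Var = Var"
proof
  fix i show "lift_subst Var i = Var i" by (cases i) auto
qed

lemma subst_Var: "subst Var \<phi> = \<phi>"
  by (induction \<phi>) (auto simp: tm_subst_Var lift_Var map_idI)

lemma tm_in_subst: "tm_in S n t \<Longrightarrow> (\<And>i. i < n \<Longrightarrow> tm_in S m (\<sigma> i)) \<Longrightarrow> tm_in S m (tm_subst \<sigma> t)"
  by (induction t) auto

lemma fm_in_subst: "fm_in S n \<phi> \<Longrightarrow> (\<And>i. i < n \<Longrightarrow> tm_in S m (\<sigma> i)) \<Longrightarrow> fm_in S m (subst \<sigma> \<phi>)"
proof (induction \<phi> arbitrary: \<sigma> n m)
  case (Eq x1 x2) then show ?case by (auto intro: tm_in_subst)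
next
  case (Rel x1 x2) then show ?case by (auto intro: tm_in_subst)
next
  case (And \<phi>1 \<phi>2)
  show ?case using And.IH[of n m \<sigma>] And.prems by simp
next
  case (Or \<phi>1 \<phi>2)
  show ?case using Or.IH[of n m \<sigma>] Or.prems by simp
next
  case (Disj A F)
  have "fm_in S m (subst \<sigma> (F i))" for i
    using Disj.IH[of "F i" n m \<sigma>] Disj.prems by simp
  then show ?case by simp
next
  case (Ex \<phi>)
  have "fm_in S (Suc m) (subst (lift_subst \<sigma>) \<phi>)"
  proof (rule Ex.IH)
    show "fm_in S (Suc n) \<phi>" using Ex.prems by simp
    fix i assume "i < Suc n" then show "tm_in S (Suc m) (lift_subst \<sigma> i)"
      using Ex.prems(2) by (cases i) (auto intro!: tm_in_subst)
  qed
  then show ?case by simp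
qed auto

definition isub :: "'f tm list \<Rightarrow> nat \<Rightarrow> 'f tm" where
  "isub ts = (\<lambda>i. if i < length ts then ts ! i else Var i)"

lemma inst_isub: "inst ts = subst (isub ts)"
  by (simp add: inst_def isub_def)

definition tms_in :: "('f,'r) signature \<Rightarrow> nat \<Rightarrow> 'f tm list \<Rightarrow> bool" where
  "tms_in S n ts \<longleftrightarrow> (\<forall>t\<in>set ts. tm_in S n t)"

lemma tms_in_simps [simp]:
  "tms_in S n []"
  "tms_in S n (xs @ ys) \<longleftrightarrow> tms_in S n xs \<and> tms_in S n ys"
  by (auto simp: tms_in_def)

lemma tms_in_nth [simp]: "tms_in S n ts \<Longrightarrow> i < length ts \<Longrightarrow> tm_in S n (ts ! i)"
  by (simp add: tms_in_def)

lemma fm_in_inst: "fm_in S (length ts) \<phi> \<Longrightarrow> tms_in S m ts \<Longrightarrow> fm_in S m (inst ts \<phi>)"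
  unfolding inst_isub by (erule fm_in_subst) (simp add: isub_def)

lemma subst_inst: "fm_in S (length ts) \<phi> \<Longrightarrow> subst \<sigma> (inst ts \<phi>) = inst (map (tm_subst \<sigma>) ts) \<phi>"
  unfolding inst_isub subst_comp by (erule subst_cong) (simp add: isub_def)

lemma inst_inst: "fm_in S (length us) \<phi> \<Longrightarrow> inst ts (inst us \<phi>) = inst (map (tm_subst (isub ts)) us) \<phi>"
  using subst_inst[of S us \<phi> "isub ts"] by (simp add: inst_isub)

lemma length_vars [simp]: "length (vars k n) = n" by (simp add: vars_def)
lemma nth_vars [simp]: "i < n \<Longrightarrow> vars k n ! i = Var (k + i)" by (simp add: vars_def)
lemma tms_in_vars_iff [simp]: "tms_in S m (vars k n) \<longleftrightarrow> n = 0 \<or> k + n \<le> m"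
  by (cases n) (auto simp: vars_def tms_in_def)
lemma tms_in_vars: "k + n \<le> m \<Longrightarrow> tms_in S m (vars k n)" by simp
lemma vars_0 [simp]: "vars k 0 = []" by (simp add: vars_def)

lemma inst_id: "fm_in S n \<phi> \<Longrightarrow> inst (vars 0 n) \<phi> = \<phi>"
proof -
  assume a: "fm_in S n \<phi>"
  have "inst (vars 0 n) \<phi> = subst Var \<phi>"
    unfolding inst_isub using a by (rule subst_cong) (simp add: isub_def)
  then show ?thesis by (simp add: subst_Var)
qed

lemma map_isub_vars: "k + n \<le> length ts \<Longrightarrow> map (tm_subst (isub ts)) (vars k n) = take n (drop k ts)"
  by (rule nth_equalityI) (auto simp: isub_def)

lemma map_subst_vars: "map (tm_subst \<sigma>) (vars k n) = map \<sigma> [k..<k+n]"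
  by (simp add: vars_def)

lemma prov_wf: "prov T n \<phi> \<psi> \<Longrightarrow> wf_gtheory T \<Longrightarrow> fm_in (sig T) n \<phi> \<and> fm_in (sig T) n \<psi>"
proof (induction rule: prov.induct)
  case (ax n \<phi> \<psi>) then show ?case by (auto simp: wf_gtheory_def)
next
  case (subst_rule n \<phi> \<psi> m \<sigma>) then show ?case by (auto intro: fm_in_subst)
next
  case (eq_leibniz i n j \<phi>) then show ?case by (auto intro!: fm_in_subst[of _ n \<phi>])
next
  case (ex_R n \<phi> \<psi>) then show ?case by (auto intro: fm_in_subst)
next
  case (frobenius n \<phi> \<psi>) then show ?case by (auto intro: fm_in_subst)
qed auto

lemma Exs_simps [simp]: "Exs 0 \<phi> = \<phi>" "Exs (Suc m) \<phi> = Ex (Exs m \<phi>)"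
  by (auto simp: Exs_def)

lemma fm_in_Exs [simp]: "fm_in S n (Exs m \<phi>) \<longleftrightarrow> fm_in S (m + n) \<phi>"
  by (induction m arbitrary: n) auto

definition weaken :: "nat \<Rightarrow> ('f,'r,'i) fm \<Rightarrow> ('f,'r,'i) fm" where
  "weaken m = subst (\<lambda>i. Var (m + i))"

lemma up_Suc: "weaken m (shift \<psi>) = weaken (Suc m) \<psi>"
  by (simp add: weaken_def subst_comp)

lemma up_0 [simp]: "weaken 0 \<phi> = \<phi>" by (simp add: weaken_def subst_Var)

lemma fm_in_up: "fm_in S n \<phi> \<Longrightarrow> fm_in S (m + n) (weaken m \<phi>)"
  unfolding weaken_def by (erule fm_in_subst) auto

lemma fm_in_shift: "fm_in S n \<phi> \<Longrightarrow> fm_in S (Suc n) (shift \<phi>)"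
  by (erule fm_in_subst) auto

lemma Exs_iff: "fm_in (sig T) n \<psi> \<Longrightarrow> prov T n (Exs m \<phi>) \<psi> \<longleftrightarrow> prov T (m + n) \<phi> (weaken m \<psi>)"
proof (induction m arbitrary: n \<psi>)
  case (Suc m)
  have "prov T n (Exs (Suc m) \<phi>) \<psi> \<longleftrightarrow> prov T (Suc n) (Exs m \<phi>) (shift \<psi>)"
    using ex_L[OF Suc.prems] ex_R by auto
  then show ?case using Suc.IH[OF fm_in_shift[OF Suc.prems]] by (simp add: up_Suc)
qed simp

definition lifts :: "nat \<Rightarrow> (nat \<Rightarrow> 'f tm) \<Rightarrow> nat \<Rightarrow> 'f tm" where
  "lifts m \<sigma> i = (if i < m then Var i else tm_subst (\<lambda>j. Var (m + j)) (\<sigma> (i - m)))"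

lemma subst_Exs: "subst \<sigma> (Exs m \<phi>) = Exs m (subst (lifts m \<sigma>) \<phi>)"
proof (induction m arbitrary: \<sigma>)
  case 0 have "lifts 0 \<sigma> = \<sigma>" by (auto simp: lifts_def tm_subst_Var)
  then show ?case by simp
next
  case (Suc m)
  have "lifts m (lift_subst \<sigma>) = lifts (Suc m) \<sigma>"
  proof
    fix i show "lifts m (lift_subst \<sigma>) i = lifts (Suc m) \<sigma> i"
    proof (cases "i \<le> m")
      case True then show ?thesis by (auto simp: lifts_def tm_subst_comp le_less)
    next
      case False
      then obtain j where "i = Suc (m + j)" using less_imp_Suc_add by (metis not_le)
      then show ?thesis by (simp add: lifts_def tm_subst_comp Suc_diff_le)
    qed
  qed
  then show ?case by (simp add: Suc)
qed

definition weaken_tms :: "nat \<Rightarrow> 'f tm list \<Rightarrow> 'f tm list" where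
  "weaken_tms m = map (tm_subst (\<lambda>i. Var (m + i)))"

lemma length_U [simp]: "length (weaken_tms m xs) = length xs" by (simp add: weaken_tms_def)

lemma nth_U: "i < length xs \<Longrightarrow> weaken_tms m xs ! i = tm_subst (\<lambda>i. Var (m + i)) (xs ! i)"
  by (simp add: weaken_tms_def)

lemma U_append [simp]: "weaken_tms m (xs @ ys) = weaken_tms m xs @ weaken_tms m ys" by (simp add: weaken_tms_def)

lemma U_vars: "weaken_tms m (vars k n) = vars (m + k) n"
  by (rule nth_equalityI) (auto simp: nth_U)

lemma map_lifts_U: "map (tm_subst (lifts m \<sigma>)) (weaken_tms m xs) = weaken_tms m (map (tm_subst \<sigma>) xs)"
  by (rule nth_equalityI) (auto simp: nth_U tm_subst_comp lifts_def)

lemma map_lifts_vars: "map (tm_subst (lifts m \<sigma>)) (vars 0 m) = vars 0 m"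
  by (rule nth_equalityI) (auto simp: lifts_def)

lemma map_isub_U:
  assumes "length ys = m" "tms_in S k xs"
  shows "map (tm_subst (isub (ys @ vars 0 k))) (weaken_tms m xs) = xs"
proof (rule nth_equalityI)
  fix i assume "i < length (map (tm_subst (isub (ys @ vars 0 k))) (weaken_tms m xs))"
  then have i: "i < length xs" by simp
  then have "tm_subst (\<lambda>j. isub (ys @ vars 0 k) (m + j)) (xs ! i) = tm_subst Var (xs ! i)"
    using assms by (intro tm_subst_cong[of S k]) (auto simp: isub_def nth_append)
  then show "map (tm_subst (isub (ys @ vars 0 k))) (weaken_tms m xs) ! i = xs ! i"
    using i by (simp add: nth_U tm_subst_comp tm_subst_Var)
qed simp

locale wf_geometric_theory = fixes T :: "('f,'r,'i) gtheory" assumes wf: "wf_gtheory T"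
begin

abbreviation "S \<equiv> sig T"

lemma wfL: "prov T n \<phi> \<psi> \<Longrightarrow> fm_in S n \<phi>" and wfR: "prov T n \<phi> \<psi> \<Longrightarrow> fm_in S n \<psi>"
  using prov_wf[OF _ wf] by blast+

lemma sub_inst: "prov T (length ts) \<phi> \<psi> \<Longrightarrow> tms_in S k ts \<Longrightarrow> prov T k (inst ts \<phi>) (inst ts \<psi>)"
  unfolding inst_isub by (erule subst_rule) (simp add: isub_def)

lemma Exs_R:
  assumes "fm_in S (m + k) \<phi>" "length ts = m" "tms_in S k ts" "prov T k \<alpha> (inst (ts @ vars 0 k) \<phi>)"
  shows "prov T k \<alpha> (Exs m \<phi>)"
proof -
  have "prov T (m + k) \<phi> (weaken m (Exs m \<phi>))"
    using Exs_iff[of T k "Exs m \<phi>" m \<phi>] ident[of T k "Exs m \<phi>"] assms by auto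
  then have "prov T k (inst (ts @ vars 0 k) \<phi>) (inst (ts @ vars 0 k) (weaken m (Exs m \<phi>)))"
    using assms(2,3) by (intro sub_inst) (auto)
  also have "inst (ts @ vars 0 k) (weaken m (Exs m \<phi>)) = subst Var (Exs m \<phi>)"
    unfolding inst_isub weaken_def subst_comp
    by (rule subst_cong[of S k]) (use assms in \<open>auto simp: isub_def nth_append\<close>)
  finally show ?thesis using assms(4) cut by (metis subst_Var)
qed

lemma frob: "fm_in S k \<alpha> \<Longrightarrow> fm_in S (m + k) \<phi> \<Longrightarrow> prov T k (And \<alpha> (Exs m \<phi>)) (Exs m (And (weaken m \<alpha>) \<phi>))"
proof (induction m arbitrary: k \<alpha>)
  case 0 then show ?case by (simp add: ident)
next
  case (Suc m)
  have 1: "prov T k (And \<alpha> (Ex (Exs m \<phi>))) (Ex (And (shift \<alpha>) (Exs m \<phi>)))"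
    using Suc.prems by (intro frobenius) auto
  have "prov T (Suc k) (And (shift \<alpha>) (Exs m \<phi>)) (Exs m (And (weaken m (shift \<alpha>)) \<phi>))"
    using Suc.prems by (intro Suc.IH fm_in_shift) auto
  then have 2: "prov T (Suc k) (And (shift \<alpha>) (Exs m \<phi>)) (Exs m (And (weaken (Suc m) \<alpha>) \<phi>))"
    by (simp add: up_Suc)
  have w: "fm_in S k (Ex (Exs m (And (weaken (Suc m) \<alpha>) \<phi>)))"
    using Suc.prems fm_in_up[OF Suc.prems(1), of "Suc m"] by simp
  have "prov T (Suc k) (Exs m (And (weaken (Suc m) \<alpha>) \<phi>)) (shift (Ex (Exs m (And (weaken (Suc m) \<alpha>) \<phi>))))"
    by (rule ex_R[OF ident[OF w]])
  then have "prov T k (Ex (And (shift \<alpha>) (Exs m \<phi>))) (Ex (Exs m (And (weaken (Suc m) \<alpha>) \<phi>)))"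
    using 2 w by (intro ex_L) (auto intro: cut)
  then show ?case using 1 by (simp add: cut)
qed

lemma Exs_E:
  assumes "prov T k \<alpha> (Exs m \<phi>)" "prov T (m + k) (And (weaken m \<alpha>) \<phi>) (weaken m \<chi>)" "fm_in S k \<chi>"
  shows "prov T k \<alpha> \<chi>"
proof -
  have w: "fm_in S k \<alpha>" "fm_in S k (Exs m \<phi>)" using assms(1) wfL wfR by blast+
  have "prov T k \<alpha> (And \<alpha> (Exs m \<phi>))" using assms(1) w by (auto intro: and_I ident)
  moreover have "prov T k (And \<alpha> (Exs m \<phi>)) (Exs m (And (weaken m \<alpha>) \<phi>))"
    using w by (intro frob) auto
  moreover have "prov T k (Exs m (And (weaken m \<alpha>) \<phi>)) \<chi>" using assms(2,3) by (simp add: Exs_iff)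
  ultimately show ?thesis using cut by blast
qed

lemma andD1: "prov T k \<alpha> (And \<phi> \<psi>) \<Longrightarrow> prov T k \<alpha> \<phi>"
  using wfR[of k \<alpha> "And \<phi> \<psi>"] by (auto intro: cut and_E1)
lemma andD2: "prov T k \<alpha> (And \<phi> \<psi>) \<Longrightarrow> prov T k \<alpha> \<psi>"
  using wfR[of k \<alpha> "And \<phi> \<psi>"] by (auto intro: cut and_E2)

lemma Ands_iff: "fm_in S k \<alpha> \<Longrightarrow> prov T k \<alpha> (Ands \<phi>s) \<longleftrightarrow> (\<forall>\<phi>\<in>set \<phi>s. prov T k \<alpha> \<phi>)"
  by (induction \<phi>s) (auto simp: Ands_def intro: top_I and_I dest: andD1 andD2)

lemma Eqs_iff: "fm_in S k \<alpha> \<Longrightarrow> length ss = length ts \<Longrightarrow>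
   prov T k \<alpha> (Eqs ss ts) \<longleftrightarrow> (\<forall>i<length ss. prov T k \<alpha> (Eq (ss ! i) (ts ! i)))"
  by (auto simp: Eqs_def Ands_iff set_zip)

lemma fm_in_Eqs: "tms_in S k ss \<Longrightarrow> tms_in S k ts \<Longrightarrow> fm_in S k (Eqs ss ts)"
  by (auto simp: Eqs_def set_zip)

lemma Eq_refl: "fm_in S k \<alpha> \<Longrightarrow> tm_in S k t \<Longrightarrow> prov T k \<alpha> (Eq t t)"
proof -
  assume a: "fm_in S k \<alpha>" "tm_in S k t"
  have "prov T k (subst (\<lambda>_. t) Top) (subst (\<lambda>_. t) (Eq (Var 0) (Var 0)))"
    using a by (intro subst_rule[of T 1] eq_refl) auto
  then show ?thesis using top_I[OF a(1)] cut by fastforce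
qed

lemma Leib1:
  assumes "fm_in S n \<phi>" "i < n" "\<forall>j<n. tm_in S k (\<sigma> j)" "tm_in S k t"
    "prov T k \<alpha> (Eq (\<sigma> i) t)" "prov T k \<alpha> (subst \<sigma> \<phi>)"
  shows "prov T k \<alpha> (subst (\<sigma>(i := t)) \<phi>)"
proof -
  have w: "fm_in S (Suc n) \<phi>" using fm_in_subst[OF assms(1), of "Suc n" Var] by (simp add: subst_Var)
  have 1: "prov T (Suc n) (And (Eq (Var i) (Var n)) \<phi>) (subst (Var(i := Var n)) \<phi>)"
    using assms(2) w by (intro eq_leibniz) auto
  let ?\<tau> = "\<sigma>(n := t)"
  have "prov T k (subst ?\<tau> (And (Eq (Var i) (Var n)) \<phi>)) (subst ?\<tau> (subst (Var(i := Var n)) \<phi>))"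
    using assms by (intro subst_rule[OF 1]) auto
  moreover have "subst ?\<tau> \<phi> = subst \<sigma> \<phi>" by (rule subst_cong[OF assms(1)]) auto
  moreover have "subst ?\<tau> (subst (Var(i := Var n)) \<phi>) = subst (\<sigma>(i := t)) \<phi>"
    unfolding subst_comp by (rule subst_cong[OF assms(1)]) auto
  ultimately have "prov T k (And (Eq (\<sigma> i) t) (subst \<sigma> \<phi>)) (subst (\<sigma>(i := t)) \<phi>)"
    using assms(2) by simp
  then show ?thesis using assms(5,6) by (blast intro: cut and_I)
qed

lemma Leib:
  assumes "fm_in S n \<phi>" "\<forall>j<n. tm_in S k (\<sigma> j)" "\<forall>j<n. tm_in S k (\<tau> j)"
    "\<forall>j<n. prov T k \<alpha> (Eq (\<sigma> j) (\<tau> j))" "prov T k \<alpha> (subst \<sigma> \<phi>)"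
  shows "prov T k \<alpha> (subst \<tau> \<phi>)"
proof -
  have "p \<le> n \<Longrightarrow> prov T k \<alpha> (subst (\<lambda>i. if i < p then \<tau> i else \<sigma> i) \<phi>)" for p
  proof (induction p)
    case (Suc p)
    have "prov T k \<alpha> (subst ((\<lambda>i. if i < p then \<tau> i else \<sigma> i)(p := \<tau> p)) \<phi>)"
      using Suc assms by (intro Leib1[of n]) auto
    moreover have "(\<lambda>i. if i < p then \<tau> i else \<sigma> i)(p := \<tau> p) = (\<lambda>i. if i < Suc p then \<tau> i else \<sigma> i)"
      by auto
    ultimately show ?case by simp
  qed (use assms in simp)
  from this[of n] have "prov T k \<alpha> (subst (\<lambda>i. if i < n then \<tau> i else \<sigma> i) \<phi>)" by simp
  moreover have "subst (\<lambda>i. if i < n then \<tau> i else \<sigma> i) \<phi> = subst \<tau> \<phi>"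
    by (rule subst_cong[OF assms(1)]) auto
  ultimately show ?thesis by simp
qed

lemma Leibs:
  assumes "fm_in S (length ss) \<phi>" "length ts = length ss" "tms_in S k ss" "tms_in S k ts"
    "\<forall>i<length ss. prov T k \<alpha> (Eq (ss ! i) (ts ! i))" "prov T k \<alpha> (inst ss \<phi>)"
  shows "prov T k \<alpha> (inst ts \<phi>)"
  unfolding inst_isub
  by (rule Leib[OF assms(1) _ _ _ assms(6)[unfolded inst_isub]])
     (use assms(2-5) in \<open>simp_all add: isub_def\<close>)

lemma Eq_sym: "prov T k \<alpha> (Eq s t) \<Longrightarrow> prov T k \<alpha> (Eq t s)"
proof -
  assume a: "prov T k \<alpha> (Eq s t)"
  have w: "tm_in S k s" "tm_in S k t" "fm_in S k \<alpha>" using wfR[OF a] wfL[OF a] by auto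
  have "prov T k \<alpha> (subst (\<lambda>i. if i = 0 then t else s) (Eq (Var 0) (Var 1)))"
    by (rule Leib[of 2 _ _ "\<lambda>_. s"]) (use w a Eq_refl[OF w(3,1)] in simp_all)
  then show ?thesis by simp
qed

lemma Eq_trans: "prov T k \<alpha> (Eq s t) \<Longrightarrow> prov T k \<alpha> (Eq t u) \<Longrightarrow> prov T k \<alpha> (Eq s u)"
proof -
  assume a: "prov T k \<alpha> (Eq s t)" "prov T k \<alpha> (Eq t u)"
  have w: "tm_in S k s" "tm_in S k t" "tm_in S k u" "fm_in S k \<alpha>"
    using wfR[OF a(1)] wfR[OF a(2)] wfL[OF a(1)] by auto
  have "prov T k \<alpha> (subst (\<lambda>i. if i = 0 then s else u) (Eq (Var 0) (Var 1)))"
    by (rule Leib[of 2 _ _ "\<lambda>i. if i = 0 then s else t"]) (use w a Eq_refl[OF w(4,1)] in simp_all)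
  then show ?thesis by simp
qed


lemma tm_in_up: "tm_in S k t \<Longrightarrow> tm_in S (m + k) (tm_subst (\<lambda>i. Var (m + i)) t)"
  by (erule tm_in_subst) simp

lemma tm_in_up_iff: "tm_in S (m + k) (tm_subst (\<lambda>i. Var (m + i)) t) \<longleftrightarrow> tm_in S k t"
  by (induction t) auto

lemma tms_in_U_iff [simp]: "tms_in S (m + k) (weaken_tms m xs) \<longleftrightarrow> tms_in S k xs"
  by (simp add: tm_in_up_iff weaken_tms_def tms_in_def)

lemma tms_in_U: "tms_in S k xs \<Longrightarrow> tms_in S (m + k) (weaken_tms m xs)" by simp

lemma up_inst: "fm_in S (length xs) \<phi> \<Longrightarrow> weaken m (inst xs \<phi>) = inst (weaken_tms m xs) \<phi>"
  unfolding weaken_def weaken_tms_def by (rule subst_inst)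

lemma prov_up: "prov T k \<alpha> \<phi> \<Longrightarrow> prov T (m + k) (weaken m \<alpha>) (weaken m \<phi>)"
  unfolding weaken_def by (erule subst_rule) auto

lemma lower: "prov T k \<alpha> \<phi> \<Longrightarrow> prov T (m + k) \<beta> (weaken m \<alpha>) \<Longrightarrow> prov T (m + k) \<beta> (weaken m \<phi>)"
  by (rule cut[OF _ prov_up])

lemma subst_Eqs: "length ss = length ts \<Longrightarrow>
   subst \<sigma> (Eqs ss ts) = Eqs (map (tm_subst \<sigma>) ss) (map (tm_subst \<sigma>) ts)"
  by (induction ss ts rule: list_induct2) (auto simp: Eqs_def Ands_def)

definition functional where "functional n \<phi> m \<psi> \<theta> \<longleftrightarrow> prov_functional T (n, \<phi>) (m, \<psi>) \<theta>"

context
  fixes n m \<phi> \<psi> \<theta>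
  assumes F: "functional n \<phi> m \<psi> \<theta>" and w: "fm_in S n \<phi>" "fm_in S m \<psi>"
begin

lemma F_wf: "fm_in S (n + m) \<theta>" using F by (simp add: functional_def prov_functional_def)

lemma F_dom:
  assumes "length xs = n" "length ys = m" "tms_in S k xs" "tms_in S k ys" "prov T k \<alpha> (inst (xs @ ys) \<theta>)"
  shows "prov T k \<alpha> (inst xs \<phi>)" "prov T k \<alpha> (inst ys \<psi>)"
proof -
  have "prov T (n + m) \<theta> (And (inst (vars 0 n) \<phi>) (inst (vars n m) \<psi>))"
    using F by (simp add: functional_def prov_functional_def)
  then have "prov T k (inst (xs @ ys) \<theta>) (inst (xs @ ys) (And (inst (vars 0 n) \<phi>) (inst (vars n m) \<psi>)))"
    using assms by (intro sub_inst) auto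
  also have "inst (xs @ ys) (And (inst (vars 0 n) \<phi>) (inst (vars n m) \<psi>)) =
     And (inst (xs @ ys) (inst (vars 0 n) \<phi>)) (inst (xs @ ys) (inst (vars n m) \<psi>))"
    by (simp add: inst_def)
  also have "\<dots> = And (inst xs \<phi>) (inst ys \<psi>)"
    using assms w by (simp add: inst_inst[of S] map_isub_vars)
  finally have "prov T k \<alpha> (And (inst xs \<phi>) (inst ys \<psi>))" by (rule cut[OF assms(5)])
  then show "prov T k \<alpha> (inst xs \<phi>)" "prov T k \<alpha> (inst ys \<psi>)" by (rule andD1, rule andD2)
qed

lemma F_uniq:
  assumes "length xs = n" "length ys = m" "length zs = m" "tms_in S k xs" "tms_in S k ys" "tms_in S k zs"
    "prov T k \<alpha> (inst (xs @ ys) \<theta>)" "prov T k \<alpha> (inst (xs @ zs) \<theta>)"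
  shows "\<forall>i<m. prov T k \<alpha> (Eq (ys ! i) (zs ! i))"
proof -
  let ?l = "xs @ ys @ zs"
  have "prov T (n + m + m) (And (inst (vars 0 n @ vars n m) \<theta>) (inst (vars 0 n @ vars (n + m) m) \<theta>))
      (Eqs (vars n m) (vars (n + m) m))"
    using F by (simp add: functional_def prov_functional_def)
  then have "prov T k (inst ?l (And (inst (vars 0 n @ vars n m) \<theta>) (inst (vars 0 n @ vars (n + m) m) \<theta>)))
     (inst ?l (Eqs (vars n m) (vars (n + m) m)))"
    using assms by (intro sub_inst) (auto simp: add.assoc)
  also have "inst ?l (And (inst (vars 0 n @ vars n m) \<theta>) (inst (vars 0 n @ vars (n + m) m) \<theta>)) =
     And (inst ?l (inst (vars 0 n @ vars n m) \<theta>)) (inst ?l (inst (vars 0 n @ vars (n + m) m) \<theta>))"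
    by (simp add: inst_def)
  also have "\<dots> = And (inst (xs @ ys) \<theta>) (inst (xs @ zs) \<theta>)"
    using assms F_wf by (simp add: inst_inst[of S] map_isub_vars)
  also have "inst ?l (Eqs (vars n m) (vars (n + m) m)) = Eqs ys zs"
    using assms by (simp add: inst_isub subst_Eqs map_isub_vars)
  finally have "prov T k \<alpha> (Eqs ys zs)" by (rule cut[OF and_I[OF assms(7,8)]])
  then show ?thesis using Eqs_iff[OF wfL[OF assms(7)], of ys zs] assms(2,3) by simp
qed

end

lemma subst_tot:
  assumes "fm_in S (length xs + m) \<theta>"
  shows "subst \<sigma> (Exs m (inst (weaken_tms m xs @ vars 0 m) \<theta>)) = Exs m (inst (weaken_tms m (map (tm_subst \<sigma>) xs) @ vars 0 m) \<theta>)"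
proof -
  have 1: "subst (lifts m \<sigma>) (inst (weaken_tms m xs @ vars 0 m) \<theta>) = inst (map (tm_subst (lifts m \<sigma>)) (weaken_tms m xs @ vars 0 m)) \<theta>"
    using assms by (intro subst_inst[of S]) simp
  then show ?thesis by (simp add: subst_Exs map_lifts_U map_lifts_vars)
qed

lemma tot_R:
  assumes "fm_in S (length xs + m) \<theta>" "length ys = m" "tms_in S k xs" "tms_in S k ys"
    "prov T k \<alpha> (inst (xs @ ys) \<theta>)"
  shows "prov T k \<alpha> (Exs m (inst (weaken_tms m xs @ vars 0 m) \<theta>))"
proof (rule Exs_R[of _ _ _ ys])
  show "fm_in S (m + k) (inst (weaken_tms m xs @ vars 0 m) \<theta>)"
    using assms tms_in_U[OF assms(3), of m]
    by (intro fm_in_inst) (auto)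
  have "inst (ys @ vars 0 k) (inst (weaken_tms m xs @ vars 0 m) \<theta>) = inst (xs @ ys) \<theta>"
    using assms by (simp add: inst_inst[of S] map_isub_vars map_isub_U[OF assms(2,3)])
  then show "prov T k \<alpha> (inst (ys @ vars 0 k) (inst (weaken_tms m xs @ vars 0 m) \<theta>))" using assms by simp
qed (use assms in auto)

lemma F_tot:
  assumes F: "functional n \<phi> m \<psi> \<theta>" and w: "fm_in S n \<phi>" "fm_in S m \<psi>"
    and "length xs = n" "tms_in S k xs" "prov T k \<alpha> (inst xs \<phi>)"
  shows "prov T k \<alpha> (Exs m (inst (weaken_tms m xs @ vars 0 m) \<theta>))"
proof -
  have U0: "weaken_tms m (vars 0 n) = vars m n" by (simp add: U_vars)
  have "prov T n \<phi> (Exs m (inst (weaken_tms m (vars 0 n) @ vars 0 m) \<theta>))"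
    using F unfolding U0 by (simp add: functional_def prov_functional_def)
  then have "prov T k (inst xs \<phi>) (inst xs (Exs m (inst (weaken_tms m (vars 0 n) @ vars 0 m) \<theta>)))"
    using assms by (intro sub_inst) auto
  also have "inst xs (Exs m (inst (weaken_tms m (vars 0 n) @ vars 0 m) \<theta>)) = Exs m (inst (weaken_tms m xs @ vars 0 m) \<theta>)"
    using assms F_wf[OF F w] unfolding inst_isub[of xs] by (subst subst_tot) (simp_all add: map_isub_vars)
  finally show ?thesis by (rule cut[OF assms(6)])
qed

lemma up_E:
  assumes "prov T k \<alpha> (Exs m \<phi>)" "fm_in S k \<chi>"
    "\<And>\<beta>. prov T (m + k) \<beta> (weaken m \<alpha>) \<Longrightarrow> prov T (m + k) \<beta> \<phi> \<Longrightarrow> prov T (m + k) \<beta> (weaken m \<chi>)"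
  shows "prov T k \<alpha> \<chi>"
proof (rule Exs_E[OF assms(1) _ assms(2)])
  have "fm_in S (m + k) (weaken m \<alpha>)" "fm_in S (m + k) \<phi>"
    using wfL[OF assms(1)] wfR[OF assms(1)] by (auto intro: fm_in_up)
  then show "prov T (m + k) (And (weaken m \<alpha>) \<phi>) (weaken m \<chi>)"
    by (intro assms(3) and_E1 and_E2)
qed

lemma functional_I:
  assumes w: "fm_in S n \<phi>" "fm_in S m \<psi>" "fm_in S (n + m) \<theta>"
    and 1: "\<And>k \<alpha> xs ys. length xs = n \<Longrightarrow> length ys = m \<Longrightarrow> tms_in S k xs \<Longrightarrow> tms_in S k ys \<Longrightarrow>
      prov T k \<alpha> (inst (xs @ ys) \<theta>) \<Longrightarrow> prov T k \<alpha> (inst xs \<phi>) \<and> prov T k \<alpha> (inst ys \<psi>)"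
    and 2: "\<And>k \<alpha> xs. length xs = n \<Longrightarrow> tms_in S k xs \<Longrightarrow> prov T k \<alpha> (inst xs \<phi>) \<Longrightarrow>
      prov T k \<alpha> (Exs m (inst (weaken_tms m xs @ vars 0 m) \<theta>))"
    and 3: "\<And>k \<alpha> xs ys zs. length xs = n \<Longrightarrow> length ys = m \<Longrightarrow> length zs = m \<Longrightarrow>
      tms_in S k xs \<Longrightarrow> tms_in S k ys \<Longrightarrow> tms_in S k zs \<Longrightarrow>
      prov T k \<alpha> (inst (xs @ ys) \<theta>) \<Longrightarrow> prov T k \<alpha> (inst (xs @ zs) \<theta>) \<Longrightarrow>
      \<forall>i<m. prov T k \<alpha> (Eq (ys ! i) (zs ! i))"
  shows "functional n \<phi> m \<psi> \<theta>"
proof -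
  have v: "vars 0 n @ vars n m = vars 0 (n + m)"
    unfolding vars_def by (simp flip: map_append upt_add_eq_append)
  have a: "prov T (n + m) \<theta> (inst (vars 0 n @ vars n m) \<theta>)"
    unfolding v using w by (simp add: inst_id[of S] ident)
  have "prov T (n + m) \<theta> (And (inst (vars 0 n) \<phi>) (inst (vars n m) \<psi>))"
    using 1[OF _ _ _ _ a] tms_in_vars[of 0 n "n + m" S] tms_in_vars[of n m "n + m" S] by (auto intro!: and_I)
  moreover have U0: "weaken_tms m (vars 0 n) = vars m n" by (simp add: U_vars)
  have "prov T n \<phi> (Exs m (inst (weaken_tms m (vars 0 n) @ vars 0 m) \<theta>))"
    using w by (intro 2) (auto simp: tms_in_vars inst_id[of S] ident)
  moreover
  let ?\<alpha> = "And (inst (vars 0 n @ vars n m) \<theta>) (inst (vars 0 n @ vars (n + m) m) \<theta>)"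
  have ww: "fm_in S (n + m + m) (inst (vars 0 n @ vars n m) \<theta>)"
    "fm_in S (n + m + m) (inst (vars 0 n @ vars (n + m) m) \<theta>)"
    using w by (auto intro!: fm_in_inst)
  have "\<forall>i<m. prov T (n + m + m) ?\<alpha> (Eq (vars n m ! i) (vars (n + m) m ! i))"
    using ww by (intro 3[of "vars 0 n"] and_E1 and_E2) (auto)
  then have "prov T (n + m + m) ?\<alpha> (Eqs (vars n m) (vars (n + m) m))"
    using ww by (subst Eqs_iff) auto
  ultimately show ?thesis unfolding functional_def prov_functional_def U0 using w by simp
qed

lemma equiv_I:
  assumes "fm_in S (n + p) \<theta>" "fm_in S (n + p) \<theta>'"
    "\<And>k \<alpha> xs ys. length xs = n \<Longrightarrow> length ys = p \<Longrightarrow> tms_in S k xs \<Longrightarrow> tms_in S k ys \<Longrightarrow>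
      prov T k \<alpha> (inst (xs @ ys) \<theta>) \<Longrightarrow> prov T k \<alpha> (inst (xs @ ys) \<theta>')"
  shows "prov T (n + p) \<theta> \<theta>'"
proof -
  have v: "vars 0 n @ vars n p = vars 0 (n + p)"
    unfolding vars_def by (simp flip: map_append upt_add_eq_append)
  have "prov T (n + p) \<theta> (inst (vars 0 n @ vars n p) \<theta>')"
  proof (rule assms(3))
    show "prov T (n + p) \<theta> (inst (vars 0 n @ vars n p) \<theta>)"
      unfolding v using assms by (simp add: inst_id[of S] ident)
  qed (auto)
  then show ?thesis unfolding v using assms by (simp add: inst_id[of S])
qed


lemma inst_id_fm:
  assumes "fm_in S n \<phi>" "length xs = n" "length ys = n"
  shows "inst (xs @ ys) (id_fm n \<phi>) = And (inst xs \<phi>) (Eqs xs ys)"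
proof -
  have "inst (xs @ ys) (id_fm n \<phi>) = And (inst (xs @ ys) (inst (vars 0 n) \<phi>)) (inst (xs @ ys) (Eqs (vars 0 n) (vars n n)))"
    by (simp add: id_fm_def inst_def)
  then show ?thesis using assms by (simp add: inst_inst[of S] map_isub_vars) (simp add: inst_isub subst_Eqs map_isub_vars)
qed

lemma id_iff:
  assumes "fm_in S n \<phi>" "length xs = n" "length ys = n"
  shows "prov T k \<alpha> (inst (xs @ ys) (id_fm n \<phi>)) \<longleftrightarrow>
    prov T k \<alpha> (inst xs \<phi>) \<and> (\<forall>i<n. prov T k \<alpha> (Eq (xs ! i) (ys ! i)))"
proof -
  have l: "length xs = length ys" using assms by simp
  show ?thesis unfolding inst_id_fm[OF assms]
  proof
    assume a: "prov T k \<alpha> (And (inst xs \<phi>) (Eqs xs ys))"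
    show "prov T k \<alpha> (inst xs \<phi>) \<and> (\<forall>i<n. prov T k \<alpha> (Eq (xs ! i) (ys ! i)))"
      using andD1[OF a] andD2[OF a] Eqs_iff[OF wfL[OF a] l] assms by simp
  next
    assume a: "prov T k \<alpha> (inst xs \<phi>) \<and> (\<forall>i<n. prov T k \<alpha> (Eq (xs ! i) (ys ! i)))"
    then have a': "prov T k \<alpha> (inst xs \<phi>)" by simp
    show "prov T k \<alpha> (And (inst xs \<phi>) (Eqs xs ys))"
      using a a' Eqs_iff[OF wfL[OF a'] l] assms by (simp add: and_I)
  qed
qed

lemma fm_in_id_fm: "fm_in S n \<phi> \<Longrightarrow> fm_in S (n + n) (id_fm n \<phi>)"
  by (auto simp: id_fm_def intro!: fm_in_inst fm_in_Eqs)

lemma id_functional: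
  assumes w: "fm_in S n \<phi>"
  shows "functional n \<phi> n \<phi> (id_fm n \<phi>)"
proof (rule functional_I[OF w w fm_in_id_fm[OF w]])
  fix k \<alpha> and xs ys :: "'f tm list"
  assume *: "length xs = n" "length ys = n" "tms_in S k xs" "tms_in S k ys"
    "prov T k \<alpha> (inst (xs @ ys) (id_fm n \<phi>))"
  then have a: "prov T k \<alpha> (inst xs \<phi>)" "\<forall>i<n. prov T k \<alpha> (Eq (xs ! i) (ys ! i))"
    using id_iff[OF w *(1,2), of k \<alpha>] by simp_all
  have "prov T k \<alpha> (inst ys \<phi>)"
    using * a(2) w by (intro Leibs[OF _ _ _ _ _ a(1)]) simp_all
  then show "prov T k \<alpha> (inst xs \<phi>) \<and> prov T k \<alpha> (inst ys \<phi>)"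
    using a(1) by simp
next
  fix k \<alpha> and xs :: "'f tm list"
  assume *: "length xs = n" "tms_in S k xs" "prov T k \<alpha> (inst xs \<phi>)"
  have "prov T k \<alpha> (inst (xs @ xs) (id_fm n \<phi>))"
    using * w id_iff[OF w, of xs xs] wfL[OF *(3)] by (auto intro!: Eq_refl)
  then show "prov T k \<alpha> (Exs n (inst (weaken_tms n xs @ vars 0 n) (id_fm n \<phi>)))"
    using * fm_in_id_fm[OF w] by (intro tot_R[of xs n _ xs]) auto
next
  fix k \<alpha> and xs ys zs :: "'f tm list"
  assume *: "length xs = n" "length ys = n" "length zs = n" "tms_in S k xs" "tms_in S k ys"
    "tms_in S k zs" "prov T k \<alpha> (inst (xs @ ys) (id_fm n \<phi>))" "prov T k \<alpha> (inst (xs @ zs) (id_fm n \<phi>))"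
  have "\<forall>i<n. prov T k \<alpha> (Eq (xs ! i) (ys ! i))" "\<forall>i<n. prov T k \<alpha> (Eq (xs ! i) (zs ! i))"
    using *(7,8) unfolding id_iff[OF w *(1,2)] id_iff[OF w *(1,3)] by simp_all
  then have "prov T k \<alpha> (Eq (ys ! i) (zs ! i))" if "i < n" for i
    using that by (intro Eq_trans[OF Eq_sym[of k \<alpha> "xs ! i" "ys ! i"]]) simp_all
  then show "\<forall>i<n. prov T k \<alpha> (Eq (ys ! i) (zs ! i))" by simp
qed

lemma fm_in_comp_fm:
  assumes "fm_in S (n + m) \<theta>" "fm_in S (m + p) \<gamma>"
  shows "fm_in S (n + p) (comp_fm n m p \<gamma> \<theta>)"
  using assms unfolding comp_fm_def by (simp add: fm_in_inst)

lemma inst_comp_fm: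
  assumes w: "fm_in S (n + m) \<theta>" "fm_in S (m + p) \<gamma>" and l: "length xs = n" "length zs = p"
  shows "inst (xs @ zs) (comp_fm n m p \<gamma> \<theta>) =
    Exs m (And (inst (weaken_tms m xs @ vars 0 m) \<theta>) (inst (vars 0 m @ weaken_tms m zs) \<gamma>))"
proof -
  let ?\<sigma> = "lifts m (isub (xs @ zs))"
  have 1: "map (tm_subst ?\<sigma>) (vars m n) = weaken_tms m xs" "map (tm_subst ?\<sigma>) (vars (m + n) p) = weaken_tms m zs"
    "map (tm_subst ?\<sigma>) (vars 0 m) = vars 0 m"
    using l by (simp_all add: list_eq_iff_nth_eq lifts_def isub_def nth_append nth_U)
  have "subst ?\<sigma> (inst (vars m n @ vars 0 m) \<theta>) = inst (weaken_tms m xs @ vars 0 m) \<theta>"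
    "subst ?\<sigma> (inst (vars 0 m @ vars (m + n) p) \<gamma>) = inst (vars 0 m @ weaken_tms m zs) \<gamma>"
    using w by (simp_all add: subst_inst[of S] 1)
  then show ?thesis unfolding inst_isub[of "xs @ zs"] comp_fm_def by (simp add: subst_Exs)
qed

context
  fixes n m p and \<theta> \<gamma> :: "('f,'r,'i) fm"
  assumes w: "fm_in S (n + m) \<theta>" "fm_in S (m + p) \<gamma>"
begin

lemma comp_I:
  assumes l: "length xs = n" "length ys = m" "length zs = p"
    "tms_in S k xs" "tms_in S k ys" "tms_in S k zs"
    "prov T k \<alpha> (inst (xs @ ys) \<theta>)" "prov T k \<alpha> (inst (ys @ zs) \<gamma>)"
  shows "prov T k \<alpha> (inst (xs @ zs) (comp_fm n m p \<gamma> \<theta>))"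
  unfolding inst_comp_fm[OF w l(1,3)]
proof (rule Exs_R[of _ _ _ ys])
  show "fm_in S (m + k) (And (inst (weaken_tms m xs @ vars 0 m) \<theta>) (inst (vars 0 m @ weaken_tms m zs) \<gamma>))"
    using w l by (auto intro!: fm_in_inst)
  have "map (tm_subst (isub (ys @ vars 0 k))) (weaken_tms m xs) = xs" "map (tm_subst (isub (ys @ vars 0 k))) (weaken_tms m zs) = zs"
    using l by (auto intro: map_isub_U[of _ _ S])
  moreover have "map (tm_subst (isub (ys @ vars 0 k))) (vars 0 m) = ys" using l by (simp add: map_isub_vars)
  moreover have "inst (ys @ vars 0 k) (And (inst (weaken_tms m xs @ vars 0 m) \<theta>) (inst (vars 0 m @ weaken_tms m zs) \<gamma>)) =
      And (inst (ys @ vars 0 k) (inst (weaken_tms m xs @ vars 0 m) \<theta>)) (inst (ys @ vars 0 k) (inst (vars 0 m @ weaken_tms m zs) \<gamma>))"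
    by (simp add: inst_def)
  ultimately have "inst (ys @ vars 0 k) (And (inst (weaken_tms m xs @ vars 0 m) \<theta>) (inst (vars 0 m @ weaken_tms m zs) \<gamma>)) =
      And (inst (xs @ ys) \<theta>) (inst (ys @ zs) \<gamma>)"
    using w l by (simp add: inst_inst[of S])
  then show "prov T k \<alpha> (inst (ys @ vars 0 k) (And (inst (weaken_tms m xs @ vars 0 m) \<theta>) (inst (vars 0 m @ weaken_tms m zs) \<gamma>)))"
    using l by (simp add: and_I)
qed (use l in auto)

lemma comp_E:
  assumes l: "length xs = n" "length zs = p" "tms_in S k xs" "tms_in S k zs"
    "prov T k \<alpha> (inst (xs @ zs) (comp_fm n m p \<gamma> \<theta>))" "fm_in S k \<chi>"
    "\<And>\<beta>. prov T (m + k) \<beta> (weaken m \<alpha>) \<Longrightarrow> prov T (m + k) \<beta> (inst (weaken_tms m xs @ vars 0 m) \<theta>) \<Longrightarrow>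
      prov T (m + k) \<beta> (inst (vars 0 m @ weaken_tms m zs) \<gamma>) \<Longrightarrow> prov T (m + k) \<beta> (weaken m \<chi>)"
  shows "prov T k \<alpha> \<chi>"
  by (rule up_E[OF l(5)[unfolded inst_comp_fm[OF w l(1,2)]] l(6)])
     (blast intro: l(7) dest: andD1 andD2)

end

lemma comp_functional:
  assumes w: "fm_in S n \<phi>" "fm_in S m \<psi>" "fm_in S p \<chi>"
    and F: "functional n \<phi> m \<psi> \<theta>" "functional m \<psi> p \<chi> \<gamma>"
  shows "functional n \<phi> p \<chi> (comp_fm n m p \<gamma> \<theta>)"
proof -
  note w\<theta> = F_wf[OF F(1) w(1,2)] and w\<gamma> = F_wf[OF F(2) w(2,3)]
  note wc = fm_in_comp_fm[OF w\<theta> w\<gamma>]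
  show ?thesis
  proof (rule functional_I[OF w(1) w(3) wc])
    fix k \<alpha> and xs ys :: "'f tm list"
    assume *: "length xs = n" "length ys = p" "tms_in S k xs" "tms_in S k ys"
      "prov T k \<alpha> (inst (xs @ ys) (comp_fm n m p \<gamma> \<theta>))"
    have "prov T k \<alpha> (inst xs \<phi>)"
    proof (rule comp_E[OF w\<theta> w\<gamma> *])
      show "fm_in S k (inst xs \<phi>)" using w * by (simp add: fm_in_inst)
      fix \<beta> assume "prov T (m + k) \<beta> (inst (weaken_tms m xs @ vars 0 m) \<theta>)"
      then have "prov T (m + k) \<beta> (inst (weaken_tms m xs) \<phi>)"
        using * by (intro F_dom(1)[OF F(1) w(1,2), of _ "vars 0 m"]) simp_all
      then show "prov T (m + k) \<beta> (weaken m (inst xs \<phi>))" using w * by (simp add: up_inst)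
    qed
    moreover have "prov T k \<alpha> (inst ys \<chi>)"
    proof (rule comp_E[OF w\<theta> w\<gamma> *])
      show "fm_in S k (inst ys \<chi>)" using w * by (simp add: fm_in_inst)
      fix \<beta> assume "prov T (m + k) \<beta> (inst (vars 0 m @ weaken_tms m ys) \<gamma>)"
      then have "prov T (m + k) \<beta> (inst (weaken_tms m ys) \<chi>)"
        using * by (intro F_dom(2)[OF F(2) w(2,3), of "vars 0 m"]) simp_all
      then show "prov T (m + k) \<beta> (weaken m (inst ys \<chi>))" using w * by (simp add: up_inst)
    qed
    ultimately show "prov T k \<alpha> (inst xs \<phi>) \<and> prov T k \<alpha> (inst ys \<chi>)" ..
  next
    fix k \<alpha> and xs :: "'f tm list"
    assume *: "length xs = n" "tms_in S k xs" "prov T k \<alpha> (inst xs \<phi>)"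
    let ?E = "\<lambda>xs. Exs p (inst (weaken_tms p xs @ vars 0 p) (comp_fm n m p \<gamma> \<theta>))"
    have E_in: "fm_in S k (?E xs)" if "length xs = n" "tms_in S k xs" for k xs
      using wc that by (simp add: fm_in_inst)
    have upE: "weaken j (?E xs) = ?E (weaken_tms j xs)" if "length xs = n" for j xs
      using wc that unfolding weaken_def weaken_tms_def[of j] by (intro subst_tot) simp
    show "prov T k \<alpha> (?E xs)"
    proof (rule up_E[OF F_tot[OF F(1) w(1,2) *] E_in[OF *(1,2)]])
      fix \<beta> assume b: "prov T (m + k) \<beta> (inst (weaken_tms m xs @ vars 0 m) \<theta>)"
      have b2: "prov T (m + k) \<beta> (inst (vars 0 m) \<psi>)"
        using * b by (intro F_dom(2)[OF F(1) w(1,2), of "weaken_tms m xs" "vars 0 m"]) simp_all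
      have in1: "tms_in S (m + k) (weaken_tms m xs)" using * by simp
      have "prov T (m + k) \<beta> (?E (weaken_tms m xs))"
      proof (rule up_E[OF F_tot[OF F(2) w(2,3) _ _ b2] E_in])
        fix \<beta>' assume c: "prov T (p + (m + k)) \<beta>' (weaken p \<beta>)"
          "prov T (p + (m + k)) \<beta>' (inst (weaken_tms p (vars 0 m) @ vars 0 p) \<gamma>)"
        have "prov T (p + (m + k)) \<beta>' (weaken p (inst (weaken_tms m xs @ vars 0 m) \<theta>))"
          by (rule lower[OF b c(1)])
        then have "prov T (p + (m + k)) \<beta>' (inst (weaken_tms p (weaken_tms m xs) @ weaken_tms p (vars 0 m)) \<theta>)"
          using w\<theta> * by (simp add: up_inst)
        then have "prov T (p + (m + k)) \<beta>' (inst (weaken_tms p (weaken_tms m xs) @ vars 0 p) (comp_fm n m p \<gamma> \<theta>))"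
          using c(2) * tms_in_U[OF in1, of p] by (intro comp_I[OF w\<theta> w\<gamma>, of _ "weaken_tms p (vars 0 m)"]) simp_all
        then have "prov T (p + (m + k)) \<beta>' (?E (weaken_tms p (weaken_tms m xs)))"
          using wc * tms_in_U[OF in1, of p] by (intro tot_R[where ys = "vars 0 p"]) simp_all
        then show "prov T (p + (m + k)) \<beta>' (weaken p (?E (weaken_tms m xs)))" using * by (simp add: upE)
      qed (use * in simp_all)
      then show "prov T (m + k) \<beta> (weaken m (?E xs))" using * by (simp add: upE)
    qed
  next
    fix k \<alpha> and xs ys zs :: "'f tm list"
    assume *: "length xs = n" "length ys = p" "length zs = p" "tms_in S k xs" "tms_in S k ys" "tms_in S k zs"
      "prov T k \<alpha> (inst (xs @ ys) (comp_fm n m p \<gamma> \<theta>))" "prov T k \<alpha> (inst (xs @ zs) (comp_fm n m p \<gamma> \<theta>))"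
    show "\<forall>i<p. prov T k \<alpha> (Eq (ys ! i) (zs ! i))"
    proof (intro allI impI)
      fix i assume i: "i < p"
      have E_in: "fm_in S k (Eq (ys ! i) (zs ! i))" using * i by simp
      show "prov T k \<alpha> (Eq (ys ! i) (zs ! i))"
      proof (rule comp_E[OF w\<theta> w\<gamma> *(1,2,4,5,7) E_in])
        fix \<beta> assume b: "prov T (m + k) \<beta> (weaken m \<alpha>)" "prov T (m + k) \<beta> (inst (weaken_tms m xs @ vars 0 m) \<theta>)"
           "prov T (m + k) \<beta> (inst (vars 0 m @ weaken_tms m ys) \<gamma>)"
        have in1: "tms_in S (m + k) (weaken_tms m xs)" "tms_in S (m + k) (weaken_tms m ys)" "tms_in S (m + k) (weaken_tms m zs)" using * by simp_all
        have b': "prov T (m + k) \<beta> (inst (weaken_tms m xs @ weaken_tms m zs) (comp_fm n m p \<gamma> \<theta>))"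
          using lower[OF *(8) b(1)] wc * by (simp add: up_inst)
        let ?\<chi> = "Eq (weaken_tms m ys ! i) (weaken_tms m zs ! i) :: ('f,'r,'i) fm"
        have "prov T (m + k) \<beta> ?\<chi>"
        proof (rule comp_E[OF w\<theta> w\<gamma> _ _ in1(1,3) b'])
          fix \<beta>' assume c: "prov T (m + (m + k)) \<beta>' (weaken m \<beta>)"
            "prov T (m + (m + k)) \<beta>' (inst (weaken_tms m (weaken_tms m xs) @ vars 0 m) \<theta>)"
            "prov T (m + (m + k)) \<beta>' (inst (vars 0 m @ weaken_tms m (weaken_tms m zs)) \<gamma>)"
          have in2: "tms_in S (m + (m + k)) (weaken_tms m (weaken_tms m xs))" "tms_in S (m + (m + k)) (weaken_tms m (weaken_tms m ys))" "tms_in S (m + (m + k)) (weaken_tms m (weaken_tms m zs))"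
             using in1[THEN tms_in_U] by simp_all
          have in3: "tms_in S (m + (m + k)) (weaken_tms m (vars 0 m))" by (intro tms_in_U) simp
          have d: "prov T (m + (m + k)) \<beta>' (inst (weaken_tms m (weaken_tms m xs) @ weaken_tms m (vars 0 m)) \<theta>)"
             "prov T (m + (m + k)) \<beta>' (inst (weaken_tms m (vars 0 m) @ weaken_tms m (weaken_tms m ys)) \<gamma>)"
            using lower[OF b(2) c(1)] lower[OF b(3) c(1)] w\<theta> w\<gamma> * by (simp_all add: up_inst)
          have e: "\<forall>j<m. prov T (m + (m + k)) \<beta>' (Eq (vars 0 m ! j) (weaken_tms m (vars 0 m) ! j))"
            using in2 in3 * by (intro F_uniq[OF F(1) w(1,2) _ _ _ _ _ _ c(2) d(1)]) simp_all
          have "prov T (m + (m + k)) \<beta>' (inst (weaken_tms m (vars 0 m) @ weaken_tms m (weaken_tms m zs)) \<gamma>)"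
          proof (rule Leibs[OF _ _ _ _ _ c(3)])
            show "\<forall>j<length (vars 0 m @ weaken_tms m (weaken_tms m zs)). prov T (m + (m + k)) \<beta>'
              (Eq ((vars 0 m @ weaken_tms m (weaken_tms m zs)) ! j) ((weaken_tms m (vars 0 m) @ weaken_tms m (weaken_tms m zs)) ! j))"
            proof (intro allI impI)
              fix j assume "j < length (vars 0 m @ weaken_tms m (weaken_tms m zs))"
              then show "prov T (m + (m + k)) \<beta>'
                  (Eq ((vars 0 m @ weaken_tms m (weaken_tms m zs)) ! j) ((weaken_tms m (vars 0 m) @ weaken_tms m (weaken_tms m zs)) ! j))"
                using e in2 *(1-3) Eq_refl[OF wfL[OF c(3)]]
                by (cases "j < m") (simp_all add: nth_append del: nth_vars)
            qed
          qed (use in2 in3 *(1-3) w\<gamma> in simp_all)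
          then have "\<forall>j<p. prov T (m + (m + k)) \<beta>' (Eq (weaken_tms m (weaken_tms m ys) ! j) (weaken_tms m (weaken_tms m zs) ! j))"
            using in2 in3 * by (intro F_uniq[OF F(2) w(2,3) _ _ _ _ _ _ d(2)]) simp_all
          then show "prov T (m + (m + k)) \<beta>' (weaken m ?\<chi>)" using i *(2,3) by (simp add: weaken_def nth_U)
        qed (use *(1-6) i in1 in simp_all)
        then show "prov T (m + k) \<beta> (weaken m (Eq (ys ! i) (zs ! i)))" using i *(2,3) by (simp add: weaken_def nth_U)
      qed
    qed
  qed
qed


lemma unit_L:
  assumes w: "fm_in S n \<phi>" "fm_in S m \<psi>" and F: "functional n \<phi> m \<psi> \<theta>"
  shows "prov_equiv T (n + m) (comp_fm n n m \<theta> (id_fm n \<phi>)) \<theta>"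
proof -
  note w\<theta> = F_wf[OF F w] and wi = fm_in_id_fm[OF w(1)]
  note wc = fm_in_comp_fm[OF wi w\<theta>]
  show ?thesis unfolding prov_equiv_def
  proof (rule conjI[OF equiv_I[OF wc w\<theta>] equiv_I[OF w\<theta> wc]])
    fix k \<alpha> and xs zs :: "'f tm list"
    assume *: "length xs = n" "length zs = m" "tms_in S k xs" "tms_in S k zs"
      "prov T k \<alpha> (inst (xs @ zs) (comp_fm n n m \<theta> (id_fm n \<phi>)))"
    show "prov T k \<alpha> (inst (xs @ zs) \<theta>)"
    proof (rule comp_E[OF wi w\<theta> *])
      show "fm_in S k (inst (xs @ zs) \<theta>)" using w\<theta> * by (simp add: fm_in_inst)
      fix \<beta> assume b: "prov T (n + k) \<beta> (inst (weaken_tms n xs @ vars 0 n) (id_fm n \<phi>))"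
        "prov T (n + k) \<beta> (inst (vars 0 n @ weaken_tms n zs) \<theta>)"
      have in1: "tms_in S (n + k) (weaken_tms n xs)" "tms_in S (n + k) (weaken_tms n zs)" using * by simp_all
      have "\<forall>i<n. prov T (n + k) \<beta> (Eq (weaken_tms n xs ! i) (vars 0 n ! i))"
        using b(1) * w id_iff[OF w(1), of "weaken_tms n xs" "vars 0 n"] by simp
      then have "\<forall>i<n. prov T (n + k) \<beta> (Eq (vars 0 n ! i) (weaken_tms n xs ! i))"
        by (intro allI impI) (rule Eq_sym, simp)
      note e = this
      have "prov T (n + k) \<beta> (inst (weaken_tms n xs @ weaken_tms n zs) \<theta>)"
      proof (rule Leibs[OF _ _ _ _ _ b(2)])
        show "\<forall>i<length (vars 0 n @ weaken_tms n zs). prov T (n + k) \<beta> (Eq ((vars 0 n @ weaken_tms n zs) ! i) ((weaken_tms n xs @ weaken_tms n zs) ! i))"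
        proof (intro allI impI)
          fix i assume "i < length (vars 0 n @ weaken_tms n zs)"
          then show "prov T (n + k) \<beta> (Eq ((vars 0 n @ weaken_tms n zs) ! i) ((weaken_tms n xs @ weaken_tms n zs) ! i))"
            using e in1 *(1,2) Eq_refl[OF wfL[OF b(2)]] by (cases "i < n") (simp_all add: nth_append del: nth_vars)
        qed
      qed (use in1 *(1,2) w\<theta> in simp_all)
      then show "prov T (n + k) \<beta> (weaken n (inst (xs @ zs) \<theta>))" using * w\<theta> by (simp add: up_inst)
    qed
  next
    fix k \<alpha> and xs zs :: "'f tm list"
    assume *: "length xs = n" "length zs = m" "tms_in S k xs" "tms_in S k zs"
      "prov T k \<alpha> (inst (xs @ zs) \<theta>)"
    have "prov T k \<alpha> (inst (xs @ xs) (id_fm n \<phi>))"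
      unfolding id_iff[OF w(1) *(1,1)]
      using F_dom(1)[OF F w *] Eq_refl[OF wfL[OF *(5)]] *(1,3) by simp
    then show "prov T k \<alpha> (inst (xs @ zs) (comp_fm n n m \<theta> (id_fm n \<phi>)))"
      using * by (intro comp_I[OF wi w\<theta>, of xs xs zs]) simp_all
  qed
qed

lemma unit_R:
  assumes w: "fm_in S n \<phi>" "fm_in S m \<psi>" and F: "functional n \<phi> m \<psi> \<theta>"
  shows "prov_equiv T (n + m) (comp_fm n m m (id_fm m \<psi>) \<theta>) \<theta>"
proof -
  note w\<theta> = F_wf[OF F w] and wi = fm_in_id_fm[OF w(2)]
  note wc = fm_in_comp_fm[OF w\<theta> wi]
  show ?thesis unfolding prov_equiv_def
  proof (rule conjI[OF equiv_I[OF wc w\<theta>] equiv_I[OF w\<theta> wc]])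
    fix k \<alpha> and xs zs :: "'f tm list"
    assume *: "length xs = n" "length zs = m" "tms_in S k xs" "tms_in S k zs"
      "prov T k \<alpha> (inst (xs @ zs) (comp_fm n m m (id_fm m \<psi>) \<theta>))"
    show "prov T k \<alpha> (inst (xs @ zs) \<theta>)"
    proof (rule comp_E[OF w\<theta> wi *])
      show "fm_in S k (inst (xs @ zs) \<theta>)" using w\<theta> * by (simp add: fm_in_inst)
      fix \<beta> assume b: "prov T (m + k) \<beta> (inst (weaken_tms m xs @ vars 0 m) \<theta>)"
        "prov T (m + k) \<beta> (inst (vars 0 m @ weaken_tms m zs) (id_fm m \<psi>))"
      have in1: "tms_in S (m + k) (weaken_tms m xs)" "tms_in S (m + k) (weaken_tms m zs)" using * by simp_all
      have "\<forall>i<m. prov T (m + k) \<beta> (Eq (vars 0 m ! i) (weaken_tms m zs ! i))"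
        using b(2) * w id_iff[OF w(2), of "vars 0 m" "weaken_tms m zs"] by simp
      note e = this
      have "prov T (m + k) \<beta> (inst (weaken_tms m xs @ weaken_tms m zs) \<theta>)"
      proof (rule Leibs[OF _ _ _ _ _ b(1)])
        show "\<forall>i<length (weaken_tms m xs @ vars 0 m). prov T (m + k) \<beta> (Eq ((weaken_tms m xs @ vars 0 m) ! i) ((weaken_tms m xs @ weaken_tms m zs) ! i))"
        proof (intro allI impI)
          fix i assume "i < length (weaken_tms m xs @ vars 0 m)"
          then show "prov T (m + k) \<beta> (Eq ((weaken_tms m xs @ vars 0 m) ! i) ((weaken_tms m xs @ weaken_tms m zs) ! i))"
            using e in1 *(1,2) Eq_refl[OF wfL[OF b(2)]] by (cases "i < n") (simp_all add: nth_append del: nth_vars)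
        qed
      qed (use in1 *(1,2) w\<theta> in simp_all)
      then show "prov T (m + k) \<beta> (weaken m (inst (xs @ zs) \<theta>))" using * w\<theta> by (simp add: up_inst)
    qed
  next
    fix k \<alpha> and xs zs :: "'f tm list"
    assume *: "length xs = n" "length zs = m" "tms_in S k xs" "tms_in S k zs"
      "prov T k \<alpha> (inst (xs @ zs) \<theta>)"
    have "prov T k \<alpha> (inst (zs @ zs) (id_fm m \<psi>))"
      unfolding id_iff[OF w(2) *(2,2)]
      using F_dom(2)[OF F w *] Eq_refl[OF wfL[OF *(5)]] *(2,4) by simp
    then show "prov T k \<alpha> (inst (xs @ zs) (comp_fm n m m (id_fm m \<psi>) \<theta>))"
      using * by (intro comp_I[OF w\<theta> wi, of xs zs zs]) simp_all
  qed
qed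

lemma assoc_prov:
  assumes w: "fm_in S (n + m) f" "fm_in S (m + p) g" "fm_in S (p + q) h"
  shows "prov_equiv T (n + q) (comp_fm n p q h (comp_fm n m p g f)) (comp_fm n m q (comp_fm m p q h g) f)"
proof -
  note wgf = fm_in_comp_fm[OF w(1,2)] and whg = fm_in_comp_fm[OF w(2,3)]
  note wl = fm_in_comp_fm[OF wgf w(3)] and wr = fm_in_comp_fm[OF w(1) whg]
  show ?thesis unfolding prov_equiv_def
  proof (rule conjI[OF equiv_I[OF wl wr] equiv_I[OF wr wl]])
    fix k \<alpha> and xs zs :: "'f tm list"
    assume *: "length xs = n" "length zs = q" "tms_in S k xs" "tms_in S k zs"
      "prov T k \<alpha> (inst (xs @ zs) (comp_fm n p q h (comp_fm n m p g f)))"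
    let ?R = "comp_fm n m q (comp_fm m p q h g) f"
    have R_in: "fm_in S k (inst (xs @ zs) ?R)" if "length xs = n" "length zs = q" "tms_in S k xs" "tms_in S k zs" for k xs zs
      using wr that by (simp add: fm_in_inst)
    show "prov T k \<alpha> (inst (xs @ zs) ?R)"
    proof (rule comp_E[OF wgf w(3) * R_in[OF *(1-4)]])
      fix \<beta> assume b: "prov T (p + k) \<beta> (inst (weaken_tms p xs @ vars 0 p) (comp_fm n m p g f))"
        "prov T (p + k) \<beta> (inst (vars 0 p @ weaken_tms p zs) h)"
      have in1: "tms_in S (p + k) (weaken_tms p xs)" "tms_in S (p + k) (weaken_tms p zs)" "tms_in S (p + k) (vars 0 p)" using * by simp_all
      have "prov T (p + k) \<beta> (inst (weaken_tms p xs @ weaken_tms p zs) ?R)"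
      proof (rule comp_E[OF w(1,2) _ _ in1(1,3) b(1) R_in])
        fix \<beta>' assume c: "prov T (m + (p + k)) \<beta>' (weaken m \<beta>)"
          "prov T (m + (p + k)) \<beta>' (inst (weaken_tms m (weaken_tms p xs) @ vars 0 m) f)"
          "prov T (m + (p + k)) \<beta>' (inst (vars 0 m @ weaken_tms m (vars 0 p)) g)"
        have in2: "tms_in S (m + (p + k)) (weaken_tms m (weaken_tms p xs))" "tms_in S (m + (p + k)) (weaken_tms m (weaken_tms p zs))" "tms_in S (m + (p + k)) (weaken_tms m (vars 0 p))"
          using in1[THEN tms_in_U] by simp_all
        have d: "prov T (m + (p + k)) \<beta>' (inst (weaken_tms m (vars 0 p) @ weaken_tms m (weaken_tms p zs)) h)"
          using lower[OF b(2) c(1)] w * by (simp add: up_inst)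
        have "prov T (m + (p + k)) \<beta>' (inst (vars 0 m @ weaken_tms m (weaken_tms p zs)) (comp_fm m p q h g))"
          using in2 * by (intro comp_I[OF w(2,3) _ _ _ _ _ _ c(3) d]) simp_all
        then have "prov T (m + (p + k)) \<beta>' (inst (weaken_tms m (weaken_tms p xs) @ weaken_tms m (weaken_tms p zs)) ?R)"
          using in2 * by (intro comp_I[OF w(1) whg _ _ _ _ _ _ c(2)]) simp_all
        then show "prov T (m + (p + k)) \<beta>' (weaken m (inst (weaken_tms p xs @ weaken_tms p zs) ?R))"
          using wr * by (simp add: up_inst)
      qed (use *(1-4) in1 in simp_all)
      then show "prov T (p + k) \<beta> (weaken p (inst (xs @ zs) ?R))" using wr * by (simp add: up_inst)
    qed
  next
    fix k \<alpha> and xs zs :: "'f tm list"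
    assume *: "length xs = n" "length zs = q" "tms_in S k xs" "tms_in S k zs"
      "prov T k \<alpha> (inst (xs @ zs) (comp_fm n m q (comp_fm m p q h g) f))"
    let ?R = "comp_fm n p q h (comp_fm n m p g f)"
    have R_in: "fm_in S k (inst (xs @ zs) ?R)" if "length xs = n" "length zs = q" "tms_in S k xs" "tms_in S k zs" for k xs zs
      using wl that by (simp add: fm_in_inst)
    show "prov T k \<alpha> (inst (xs @ zs) ?R)"
    proof (rule comp_E[OF w(1) whg * R_in[OF *(1-4)]])
      fix \<beta> assume b: "prov T (m + k) \<beta> (inst (weaken_tms m xs @ vars 0 m) f)"
        "prov T (m + k) \<beta> (inst (vars 0 m @ weaken_tms m zs) (comp_fm m p q h g))"
      have in1: "tms_in S (m + k) (weaken_tms m xs)" "tms_in S (m + k) (weaken_tms m zs)" "tms_in S (m + k) (vars 0 m)" using * by simp_all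
      have "prov T (m + k) \<beta> (inst (weaken_tms m xs @ weaken_tms m zs) ?R)"
      proof (rule comp_E[OF w(2,3) _ _ in1(3,2) b(2) R_in])
        fix \<beta>' assume c: "prov T (p + (m + k)) \<beta>' (weaken p \<beta>)"
          "prov T (p + (m + k)) \<beta>' (inst (weaken_tms p (vars 0 m) @ vars 0 p) g)"
          "prov T (p + (m + k)) \<beta>' (inst (vars 0 p @ weaken_tms p (weaken_tms m zs)) h)"
        have in2: "tms_in S (p + (m + k)) (weaken_tms p (weaken_tms m xs))" "tms_in S (p + (m + k)) (weaken_tms p (weaken_tms m zs))" "tms_in S (p + (m + k)) (weaken_tms p (vars 0 m))"
          using in1[THEN tms_in_U] by simp_all
        have d: "prov T (p + (m + k)) \<beta>' (inst (weaken_tms p (weaken_tms m xs) @ weaken_tms p (vars 0 m)) f)"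
          using lower[OF b(1) c(1)] w * by (simp add: up_inst)
        have "prov T (p + (m + k)) \<beta>' (inst (weaken_tms p (weaken_tms m xs) @ vars 0 p) (comp_fm n m p g f))"
          using in2 * by (intro comp_I[OF w(1,2) _ _ _ _ _ _ d c(2)]) simp_all
        then have "prov T (p + (m + k)) \<beta>' (inst (weaken_tms p (weaken_tms m xs) @ weaken_tms p (weaken_tms m zs)) ?R)"
          using in2 * by (intro comp_I[OF wgf w(3) _ _ _ _ _ _ _ c(3)]) simp_all
        then show "prov T (p + (m + k)) \<beta>' (weaken p (inst (weaken_tms m xs @ weaken_tms m zs) ?R))"
          using wl * by (simp add: up_inst)
      qed (use *(1-4) in1 in simp_all)
      then show "prov T (m + k) \<beta> (weaken m (inst (xs @ zs) ?R))" using wl * by (simp add: up_inst)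
    qed
  qed
qed

lemma comp_cong1:
  assumes w: "fm_in S (n + m) f" "fm_in S (m + p) g" "prov T (n + m) f f'" "prov T (m + p) g g'"
  shows "prov T (n + p) (comp_fm n m p g f) (comp_fm n m p g' f')"
proof -
  have w': "fm_in S (n + m) f'" "fm_in S (m + p) g'" using w wfR by blast+
  have mono: "prov T k \<alpha> (inst ts \<phi>')" if "prov T N \<phi> \<phi>'" "length ts = N" "tms_in S k ts" "prov T k \<alpha> (inst ts \<phi>)" for k \<alpha> ts \<phi> \<phi>' N
    using that by (intro cut[OF that(4)] sub_inst) simp_all
  show ?thesis
  proof (intro equiv_I fm_in_comp_fm w w')
    fix k \<alpha> and xs zs :: "'f tm list"
    assume *: "length xs = n" "length zs = p" "tms_in S k xs" "tms_in S k zs"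
      "prov T k \<alpha> (inst (xs @ zs) (comp_fm n m p g f))"
    show "prov T k \<alpha> (inst (xs @ zs) (comp_fm n m p g' f'))"
    proof (rule comp_E[OF w(1,2) *])
      show "fm_in S k (inst (xs @ zs) (comp_fm n m p g' f'))" using fm_in_comp_fm[OF w'] * by (simp add: fm_in_inst)
      fix \<beta> assume b: "prov T (m + k) \<beta> (inst (weaken_tms m xs @ vars 0 m) f)"
        "prov T (m + k) \<beta> (inst (vars 0 m @ weaken_tms m zs) g)"
      have in1: "tms_in S (m + k) (weaken_tms m xs)" "tms_in S (m + k) (weaken_tms m zs)" "tms_in S (m + k) (vars 0 m)" using * by simp_all
      have b': "prov T (m + k) \<beta> (inst (weaken_tms m xs @ vars 0 m) f')" "prov T (m + k) \<beta> (inst (vars 0 m @ weaken_tms m zs) g')"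
        using in1 * by (auto intro!: mono[OF w(3) _ _ b(1)] mono[OF w(4) _ _ b(2)])
      have "prov T (m + k) \<beta> (inst (weaken_tms m xs @ weaken_tms m zs) (comp_fm n m p g' f'))"
        using in1 * by (intro comp_I[OF w' _ _ _ _ _ _ b']) simp_all
      then show "prov T (m + k) \<beta> (weaken m (inst (xs @ zs) (comp_fm n m p g' f')))"
        using fm_in_comp_fm[OF w'] * by (simp add: up_inst)
    qed
  qed
qed

lemma prov_class_eq: "prov_equiv T n \<theta> \<theta>' \<Longrightarrow> prov_class T n \<theta> = prov_class T n \<theta>'"
  unfolding prov_class_def prov_equiv_def by (auto intro: cut)

lemma Cmp_class:
  assumes w: "fm_in S (n + m) f" "fm_in S (m + p) g"
  shows "Cmp (syntactic_category T) (n, \<phi>) (m, \<psi>) (p, \<chi>) (prov_class T (m + p) g) (prov_class T (n + m) f) =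
    prov_class T (n + p) (comp_fm n m p g f)"
proof -
  have "prov_class T (n + p) (comp_fm n m p g' f') = prov_class T (n + p) (comp_fm n m p g f)"
    if "f' \<in> prov_class T (n + m) f" "g' \<in> prov_class T (m + p) g" for f' g'
  proof (rule prov_class_eq)
    have p: "prov T (n + m) f f'" "prov T (n + m) f' f" "prov T (m + p) g g'" "prov T (m + p) g' g"
      using that by (simp_all add: prov_class_def prov_equiv_def)
    show "prov_equiv T (n + p) (comp_fm n m p g' f') (comp_fm n m p g f)"
      unfolding prov_equiv_def
      using comp_cong1[OF w p(1,3)] comp_cong1[OF wfL[OF p(2)] wfL[OF p(4)] p(2,4)] by simp
  qed
  then have "(\<Union>f'\<in>prov_class T (n + m) f. \<Union>g'\<in>prov_class T (m + p) g.
      prov_class T (n + p) (comp_fm n m p g' f')) =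
      (\<Union>f'\<in>prov_class T (n + m) f. \<Union>g'\<in>prov_class T (m + p) g.
      prov_class T (n + p) (comp_fm n m p g f))"
    by (intro SUP_cong HOL.refl)
  also have "\<dots> = prov_class T (n + p) (comp_fm n m p g f)"
  proof -
    have "f \<in> prov_class T (n + m) f" "g \<in> prov_class T (m + p) g"
      using w by (simp_all add: prov_class_def prov_equiv_def ident)
    then show ?thesis by blast
  qed
  finally show ?thesis by (simp add: syntactic_category_def)
qed

abbreviation "\<S> \<equiv> syntactic_category T"

lemma Obj_iff: "(n, \<phi>) \<in> Obj \<S> \<longleftrightarrow> fm_in S n \<phi>"
  by (simp add: syntactic_category_def)

lemma Hom_E:
  assumes "f \<in> Hom \<S> (n, \<phi>) (m, \<psi>)"
  obtains \<theta> where "functional n \<phi> m \<psi> \<theta>" "f = prov_class T (n + m) \<theta>"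
  using assms by (auto simp: syntactic_category_def functional_def)

lemma Hom_I: "functional n \<phi> m \<psi> \<theta> \<Longrightarrow> prov_class T (n + m) \<theta> \<in> Hom \<S> (n, \<phi>) (m, \<psi>)"
  by (auto simp: syntactic_category_def functional_def)

lemma Idt_class: "Idt \<S> (n, \<phi>) = prov_class T (n + n) (id_fm n \<phi>)"
  by (simp add: syntactic_category_def)

lemma syntactic_is_category: "is_category \<S>"
  unfolding is_category_def
proof (intro conjI ballI)
  fix A assume A: "A \<in> Obj \<S>"
  obtain n \<phi> where [simp]: "A = (n, \<phi>)" by (cases A)
  have "fm_in S n \<phi>" using A by (simp add: Obj_iff)
  then show "Idt \<S> A \<in> Hom \<S> A A" using Hom_I[OF id_functional] by (simp add: Idt_class)
next
  fix A B C f g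
  assume o: "A \<in> Obj \<S>" "B \<in> Obj \<S>" "C \<in> Obj \<S>" and f: "f \<in> Hom \<S> A B" and g: "g \<in> Hom \<S> B C"
  obtain n \<phi> m \<psi> p \<chi> where ABC [simp]: "A = (n, \<phi>)" "B = (m, \<psi>)" "C = (p, \<chi>)" by (cases A, cases B, cases C)
  have w: "fm_in S n \<phi>" "fm_in S m \<psi>" "fm_in S p \<chi>" using o by (simp_all add: Obj_iff)
  obtain \<theta> \<gamma> where F: "functional n \<phi> m \<psi> \<theta>" "functional m \<psi> p \<chi> \<gamma>"
    and fg: "f = prov_class T (n + m) \<theta>" "g = prov_class T (m + p) \<gamma>"
    using Hom_E[OF f[unfolded ABC]] Hom_E[OF g[unfolded ABC]] by metis
  show "Cmp \<S> A B C g f \<in> Hom \<S> A C"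
    using Hom_I[OF comp_functional[OF w F]] Cmp_class[OF F_wf[OF F(1) w(1,2)] F_wf[OF F(2) w(2,3)]]
    by (simp add: fg)
next
  fix A B f
  assume o: "A \<in> Obj \<S>" "B \<in> Obj \<S>" and f: "f \<in> Hom \<S> A B"
  obtain n \<phi> m \<psi> where AB [simp]: "A = (n, \<phi>)" "B = (m, \<psi>)" by (cases A, cases B)
  have w: "fm_in S n \<phi>" "fm_in S m \<psi>" using o by (simp_all add: Obj_iff)
  obtain \<theta> where F: "functional n \<phi> m \<psi> \<theta>" and fe: "f = prov_class T (n + m) \<theta>"
    using Hom_E[OF f[unfolded AB]] by metis
  show "Cmp \<S> A A B f (Idt \<S> A) = f"
    using Cmp_class[OF fm_in_id_fm[OF w(1)] F_wf[OF F w]] prov_class_eq[OF unit_L[OF w F]]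
    by (simp add: fe Idt_class)
  show "Cmp \<S> A B B (Idt \<S> B) f = f"
    using Cmp_class[OF F_wf[OF F w] fm_in_id_fm[OF w(2)]] prov_class_eq[OF unit_R[OF w F]]
    by (simp add: fe Idt_class)
next
  fix A B C D f g h
  assume o: "A \<in> Obj \<S>" "B \<in> Obj \<S>" "C \<in> Obj \<S>" "D \<in> Obj \<S>"
   and f: "f \<in> Hom \<S> A B" and g: "g \<in> Hom \<S> B C" and h: "h \<in> Hom \<S> C D"
  obtain n \<phi> m \<psi> p \<chi> q \<omega> where ABCD [simp]: "A = (n, \<phi>)" "B = (m, \<psi>)" "C = (p, \<chi>)" "D = (q, \<omega>)"
    by (cases A, cases B, cases C, cases D)
  have w: "fm_in S n \<phi>" "fm_in S m \<psi>" "fm_in S p \<chi>" "fm_in S q \<omega>" using o by (simp_all add: Obj_iff)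
  obtain \<theta> where F: "functional n \<phi> m \<psi> \<theta>" and fe: "f = prov_class T (n + m) \<theta>"
    using Hom_E[OF f[unfolded ABCD]] by metis
  obtain \<gamma> where G: "functional m \<psi> p \<chi> \<gamma>" and ge: "g = prov_class T (m + p) \<gamma>"
    using Hom_E[OF g[unfolded ABCD]] by metis
  obtain \<eta> where H: "functional p \<chi> q \<omega> \<eta>" and he: "h = prov_class T (p + q) \<eta>"
    using Hom_E[OF h[unfolded ABCD]] by metis
  note wF = F_wf[OF F w(1,2)] and wG = F_wf[OF G w(2,3)] and wH = F_wf[OF H w(3,4)]
  show "Cmp \<S> A C D h (Cmp \<S> A B C g f) = Cmp \<S> A B D (Cmp \<S> B C D h g) f"
    using prov_class_eq[OF assoc_prov[OF wF wG wH]]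
    by (simp add: fe ge he Cmp_class[OF wF wG] Cmp_class[OF wG wH]
      Cmp_class[OF fm_in_comp_fm[OF wF wG] wH] Cmp_class[OF wF fm_in_comp_fm[OF wG wH]])
qed

end

end

theory Submission
  imports Defs
begin

text \<open>
  A model of \<open>Loc2 I J\<close> has at least two elements, because \<open>0 = 1\<close> entails falsity,
  whereas the trivial group, with \<open>R\<^sub>k\<close> true for \<open>k = 1\<close> only, is a model of
  \<open>G_IJ I J\<close>. In the trivial group every formula-in-context denotes a subset of a
  one-element set, so no interpretation can produce two distinct elements there.

  This conflict is visible in the syntactic categories. In that of \<open>Loc2 I J\<close> the constants
  \<open>0\<close> and \<open>1\<close> are two arrows from the terminal object to \<open>{x. \<top>}\<close> that are
  disjoint: an object mapping to the terminal object and equalizing them is provably empty, hence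
  initial (\<open>has_disjoint_points_closed_terms\<close>). The existence of such a pair is invariant
  under equivalence of categories (\<open>has_disjoint_points_transfer\<close>). In a theory with a
  one-element model, two arrows \<open>f, g : X \<rightarrow> A\<close> out of a weakly terminal object denote maps
  from a point to a point. They agree there, so the formula \<open>f(x) = y \<and> g(x) = y\<close> holds in
  the model. It defines an object that equalizes \<open>f\<close> and \<open>g\<close> and, by soundness, is
  not provably empty (\<open>no_disjoint_points_singleton_model\<close>).
\<close>

section \<open>Disjoint points in a category\<close>

text \<open>
  Terminal and initial objects enter only through the existence of arrows, not their uniqueness:
  weak terminality is enough to make \<open>X\<close> inhabited in a model, and an object with an arrow to
  an empty object is empty itself.
\<close>

definition has_disjoint_points :: "('o, 'a) cat \<Rightarrow> bool" where
  "has_disjoint_points \<C> \<longleftrightarrow>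
    (\<exists>X\<in>Obj \<C>. \<exists>A\<in>Obj \<C>. \<exists>f\<in>Hom \<C> X A. \<exists>g\<in>Hom \<C> X A.
      (\<forall>B\<in>Obj \<C>. Hom \<C> B X \<noteq> {}) \<and>
      (\<forall>E\<in>Obj \<C>. \<forall>e\<in>Hom \<C> E X. Cmp \<C> E X A f e = Cmp \<C> E X A g e \<longrightarrow>
        (\<forall>B\<in>Obj \<C>. Hom \<C> E B \<noteq> {})))"

text \<open>
  If \<open>F f\<close> and \<open>F g\<close> are equalized by \<open>e : E \<rightarrow> F X\<close>, then \<open>f\<close>
  and \<open>g\<close> are equalized by the transpose \<open>\<eta>\<^sup>-\<^sup>1 \<circ> G e : G E \<rightarrow> X\<close> of
  \<open>e\<close>; so \<open>G E\<close> is weakly initial, and with it \<open>E\<close>.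
\<close>

lemma has_disjoint_points_transfer:
  assumes C: "is_category \<C>" and D: "is_category \<D>"
    and eq: "equivalent_categories \<C> \<D>" and P: "has_disjoint_points \<C>"
  shows "has_disjoint_points \<D>"
proof -
  obtain Fo Fa Go Ga \<eta> \<epsilon> where F: "is_functor \<C> \<D> Fo Fa" and G: "is_functor \<D> \<C> Go Ga"
    and eta: "is_nat_iso \<C> \<C> (\<lambda>A. A) (\<lambda>A B f. f)
      (\<lambda>A. Go (Fo A)) (\<lambda>A B f. Ga (Fo A) (Fo B) (Fa A B f)) \<eta>"
    and eps: "is_nat_iso \<D> \<D> (\<lambda>A. Fo (Go A)) (\<lambda>A B f. Fa (Go A) (Go B) (Ga A B f))
      (\<lambda>A. A) (\<lambda>A B f. f) \<epsilon>"
    using eq unfolding equivalent_categories_def by blast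
  obtain X A f g where X: "X \<in> Obj \<C>" and A: "A \<in> Obj \<C>"
    and f: "f \<in> Hom \<C> X A" and g: "g \<in> Hom \<C> X A"
    and to_X: "\<And>B. B \<in> Obj \<C> \<Longrightarrow> Hom \<C> B X \<noteq> {}"
    and disj: "\<And>E e B. E \<in> Obj \<C> \<Longrightarrow> e \<in> Hom \<C> E X \<Longrightarrow>
      Cmp \<C> E X A f e = Cmp \<C> E X A g e \<Longrightarrow> B \<in> Obj \<C> \<Longrightarrow> Hom \<C> E B \<noteq> {}"
    using P unfolding has_disjoint_points_def by blast
  have Fo: "Fo B \<in> Obj \<D>" if "B \<in> Obj \<C>" for B
    using F that unfolding is_functor_def by blast
  have Go: "Go B \<in> Obj \<C>" if "B \<in> Obj \<D>" for B
    using G that unfolding is_functor_def by blast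
  have Fa: "Fa B B' h \<in> Hom \<D> (Fo B) (Fo B')"
    if "B \<in> Obj \<C>" "B' \<in> Obj \<C>" "h \<in> Hom \<C> B B'" for B B' h
    using F that unfolding is_functor_def by blast
  have Ga: "Ga B B' h \<in> Hom \<C> (Go B) (Go B')"
    if "B \<in> Obj \<D>" "B' \<in> Obj \<D>" "h \<in> Hom \<D> B B'" for B B' h
    using G that unfolding is_functor_def by blast
  have GaC: "Ga B B'' (Cmp \<D> B B' B'' k h) =
      Cmp \<C> (Go B) (Go B') (Go B'') (Ga B' B'' k) (Ga B B' h)"
    if "B \<in> Obj \<D>" "B' \<in> Obj \<D>" "B'' \<in> Obj \<D>" "h \<in> Hom \<D> B B'" "k \<in> Hom \<D> B' B''"
    for B B' B'' h k
    using G that unfolding is_functor_def by blast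
  have CC: "Cmp \<C> B B' B'' k h \<in> Hom \<C> B B''"
    if "B \<in> Obj \<C>" "B' \<in> Obj \<C>" "B'' \<in> Obj \<C>" "h \<in> Hom \<C> B B'" "k \<in> Hom \<C> B' B''"
    for B B' B'' h k
    using C that unfolding is_category_def by blast
  have CD: "Cmp \<D> B B' B'' k h \<in> Hom \<D> B B''"
    if "B \<in> Obj \<D>" "B' \<in> Obj \<D>" "B'' \<in> Obj \<D>" "h \<in> Hom \<D> B B'" "k \<in> Hom \<D> B' B''"
    for B B' B'' h k
    using D that unfolding is_category_def by blast
  have assoc: "Cmp \<C> B1 B3 B4 l (Cmp \<C> B1 B2 B3 k h) = Cmp \<C> B1 B2 B4 (Cmp \<C> B2 B3 B4 l k) h"
    if "B1 \<in> Obj \<C>" "B2 \<in> Obj \<C>" "B3 \<in> Obj \<C>" "B4 \<in> Obj \<C>"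
      "h \<in> Hom \<C> B1 B2" "k \<in> Hom \<C> B2 B3" "l \<in> Hom \<C> B3 B4" for B1 B2 B3 B4 h k l
    using C that unfolding is_category_def by blast
  have unit: "Cmp \<C> B B' B' (Idt \<C> B') h = h" "Cmp \<C> B B B' h (Idt \<C> B) = h"
    if "B \<in> Obj \<C>" "B' \<in> Obj \<C>" "h \<in> Hom \<C> B B'" for B B' h
    using C that unfolding is_category_def by blast+
  have eps_arrows: "Hom \<D> B (Fo (Go B)) \<noteq> {}" "Hom \<D> (Fo (Go B)) B \<noteq> {}" if "B \<in> Obj \<D>" for B
    using eps that unfolding is_nat_iso_def is_iso_def by blast+
  obtain u where u: "u \<in> Hom \<C> (Go (Fo X)) X"
    "Cmp \<C> (Go (Fo X)) X (Go (Fo X)) (\<eta> X) u = Idt \<C> (Go (Fo X))"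
    and etaX: "\<eta> X \<in> Hom \<C> X (Go (Fo X))"
    using eta X unfolding is_nat_iso_def is_iso_def by blast
  obtain v where v: "v \<in> Hom \<C> (Go (Fo A)) A" "Cmp \<C> A (Go (Fo A)) A v (\<eta> A) = Idt \<C> A"
    and etaA: "\<eta> A \<in> Hom \<C> A (Go (Fo A))"
    using eta A unfolding is_nat_iso_def is_iso_def by blast
  note GFX = Go[OF Fo[OF X]] and GFA = Go[OF Fo[OF A]]
  have nat: "Cmp \<C> (Go (Fo X)) X A h u =
      Cmp \<C> (Go (Fo X)) (Go (Fo A)) A v (Ga (Fo X) (Fo A) (Fa X A h))" if h: "h \<in> Hom \<C> X A" for h
  proof -
    let ?GX = "Go (Fo X)" and ?GA = "Go (Fo A)" and ?h = "Ga (Fo X) (Fo A) (Fa X A h)"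
    have h': "?h \<in> Hom \<C> ?GX ?GA" using X A h by (intro Ga Fa Fo)
    have "Cmp \<C> ?GX X A h u = Cmp \<C> ?GX X A (Cmp \<C> X A A (Idt \<C> A) h) u"
      using unit(1)[OF X A h] by simp
    also have "\<dots> = Cmp \<C> ?GX X A (Cmp \<C> X ?GA A v (Cmp \<C> X A ?GA (\<eta> A) h)) u"
      using assoc[OF X A GFA A h etaA v(1)] v(2) by simp
    also have "Cmp \<C> X A ?GA (\<eta> A) h = Cmp \<C> X ?GX ?GA ?h (\<eta> X)"
      using eta X A h unfolding is_nat_iso_def by blast
    also have "Cmp \<C> ?GX X A (Cmp \<C> X ?GA A v (Cmp \<C> X ?GX ?GA ?h (\<eta> X))) u =
        Cmp \<C> ?GX ?GA A v (Cmp \<C> ?GX X ?GA (Cmp \<C> X ?GX ?GA ?h (\<eta> X)) u)"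
      using assoc[OF GFX X GFA A u(1) CC[OF X GFX GFA etaX h'] v(1)] by simp
    also have "Cmp \<C> ?GX X ?GA (Cmp \<C> X ?GX ?GA ?h (\<eta> X)) u =
        Cmp \<C> ?GX ?GX ?GA ?h (Cmp \<C> ?GX X ?GX (\<eta> X) u)"
      using assoc[OF GFX X GFX GFA u(1) etaX h'] by simp
    also have "\<dots> = ?h"
      unfolding u(2) by (rule unit(2)[OF GFX GFA h'])
    finally show ?thesis .
  qed
  show ?thesis unfolding has_disjoint_points_def
  proof (intro bexI conjI ballI impI)
    fix B assume B: "B \<in> Obj \<D>"
    obtain t b where "t \<in> Hom \<C> (Go B) X" "b \<in> Hom \<D> B (Fo (Go B))"
      using to_X[OF Go[OF B]] eps_arrows[OF B] by blast
    then show "Hom \<D> B (Fo X) \<noteq> {}"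
      using CD[OF B Fo[OF Go[OF B]] Fo[OF X] _ Fa[OF Go[OF B] X]] by blast
  next
    fix E e B
    assume E: "E \<in> Obj \<D>" and e: "e \<in> Hom \<D> E (Fo X)" and B: "B \<in> Obj \<D>"
      and equ: "Cmp \<D> E (Fo X) (Fo A) (Fa X A f) e = Cmp \<D> E (Fo X) (Fo A) (Fa X A g) e"
    let ?Ge = "Ga E (Fo X) e"
    have Ge: "?Ge \<in> Hom \<C> (Go E) (Go (Fo X))" using Ga E Fo X e by blast
    have transpose: "Cmp \<C> (Go E) X A h (Cmp \<C> (Go E) (Go (Fo X)) X u ?Ge) =
        Cmp \<C> (Go E) (Go (Fo A)) A v (Ga E (Fo A) (Cmp \<D> E (Fo X) (Fo A) (Fa X A h) e))"
      if h: "h \<in> Hom \<C> X A" for h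
      using assoc[OF Go[OF E] GFX X A Ge u(1) h]
        assoc[OF Go[OF E] GFX GFA A Ge Ga[OF Fo[OF X] Fo[OF A] Fa[OF X A h]] v(1)]
        GaC[OF E Fo[OF X] Fo[OF A] e Fa[OF X A h]] nat[OF h] by simp
    have "Hom \<C> (Go E) (Go B) \<noteq> {}"
      using disj[OF Go[OF E] CC[OF Go[OF E] GFX X Ge u(1)] _ Go[OF B]]
        transpose[OF f] transpose[OF g] equ by simp
    then obtain w where "w \<in> Hom \<C> (Go E) (Go B)" by blast
    then have w: "Fa (Go E) (Go B) w \<in> Hom \<D> (Fo (Go E)) (Fo (Go B))"
      using Fa Go E B by blast
    obtain p q where "p \<in> Hom \<D> E (Fo (Go E))" "q \<in> Hom \<D> (Fo (Go B)) B"
      using eps_arrows E B by blast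
    then show "Hom \<D> E B \<noteq> {}"
      using CD[OF E Fo[OF Go[OF E]] B _ CD[OF Fo[OF Go[OF E]] Fo[OF Go[OF B]] B w]] by blast
  qed (use Fo Fa X A f g in auto)
qed


section \<open>Theories with two closed terms that are never equal\<close>

lemma tm_subst_closed: "tm_in S 0 t \<Longrightarrow> tm_subst \<sigma> t = t"
  using tm_subst_cong[of S 0 t \<sigma> Var] by (simp add: tm_subst_Var)

lemma tm_in_closed: "tm_in S 0 t \<Longrightarrow> tm_in S k t"
  using tm_in_subst[of S 0 t k Var] by (simp add: tm_subst_Var)

lemma weaken_tms_0: "weaken_tms 0 xs = xs"
  by (simp add: weaken_tms_def tm_subst_Var map_idI)

lemma inst_Top: "inst ts Top = Top" and inst_Bot: "inst ts Bot = Bot"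
  by (simp_all add: inst_def)

lemma inst_Eq_closed: "tm_in S 0 s \<Longrightarrow> inst [z] (Eq (Var 0) s) = Eq z s"
  by (simp add: inst_def tm_subst_closed)

lemma (in wf_geometric_theory) functional_closed_term:
  assumes s: "tm_in S 0 s"
  shows "functional 0 Top 1 Top (Eq (Var 0) s)"
proof (rule functional_I)
  show w: "fm_in S (0 + 1) (Eq (Var 0) s)" using tm_in_closed[OF s] by simp
  have single: "\<exists>y. ys = [y]" if "length ys = 1" for ys :: "'f tm list"
    using that by (simp add: length_Suc_conv)
  {
    fix k \<alpha> and xs :: "'f tm list"
    assume *: "length xs = 0" "prov T k \<alpha> (inst xs Top)"
    have "prov T k \<alpha> (inst (xs @ [s]) (Eq (Var 0) s))"
      using * Eq_refl[OF wfL[OF *(2)] tm_in_closed[OF s]] by (simp add: inst_Eq_closed[OF s])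
    then show "prov T k \<alpha> (Exs 1 (inst (weaken_tms 1 xs @ vars 0 1) (Eq (Var 0) s)))"
      using * w tm_in_closed[OF s] by (intro tot_R[of xs 1 _ "[s]"]) (simp_all add: tms_in_def)
  next
    fix k \<alpha> and xs ys zs :: "'f tm list"
    assume *: "length xs = 0" "length ys = 1" "length zs = 1"
      "prov T k \<alpha> (inst (xs @ ys) (Eq (Var 0) s))" "prov T k \<alpha> (inst (xs @ zs) (Eq (Var 0) s))"
    obtain y z where yz: "ys = [y]" "zs = [z]" using single[OF *(2)] single[OF *(3)] by blast
    have y: "prov T k \<alpha> (Eq (ys ! 0) s)" and z: "prov T k \<alpha> (Eq (zs ! 0) s)"
      using * by (simp_all add: yz inst_Eq_closed[OF s])
    have "prov T k \<alpha> (Eq (ys ! 0) (zs ! 0))" by (rule Eq_trans[OF y Eq_sym[OF z]])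
    then show "\<forall>i<1. prov T k \<alpha> (Eq (ys ! i) (zs ! i))" by simp
  }
qed (auto simp: inst_def intro: top_I dest: wfL)

lemma (in wf_geometric_theory) functional_to_terminal:
  assumes w: "fm_in S n \<phi>"
  shows "functional n \<phi> 0 Top \<phi>"
proof (rule functional_I)
  fix k \<alpha> and xs :: "'f tm list"
  assume "length xs = n" "tms_in S k xs" "prov T k \<alpha> (inst xs \<phi>)"
  then show "prov T k \<alpha> (Exs 0 (inst (weaken_tms 0 xs @ vars 0 0) \<phi>))"
    by (simp add: weaken_tms_0)
qed (use w in \<open>auto simp: inst_Top intro: top_I dest: wfL\<close>)

lemma (in wf_geometric_theory) functional_from_empty:
  assumes empty: "prov T n \<phi> Bot" and w: "fm_in S m \<psi>"
  shows "functional n \<phi> m \<psi> Bot"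
proof (rule functional_I)
  note w\<phi> = wfL[OF empty]
  have bot: "prov T k \<alpha> \<chi>" if "prov T k \<alpha> Bot" "fm_in S k \<chi>" for k \<alpha> \<chi>
    using that by (blast intro: cut bot_E)
  show "fm_in S n \<phi>" "fm_in S m \<psi>" "fm_in S (n + m) Bot" using w\<phi> w by simp_all
  {
    fix k \<alpha> and xs ys :: "'f tm list"
    assume "length xs = n" "length ys = m" "tms_in S k xs" "tms_in S k ys"
      "prov T k \<alpha> (inst (xs @ ys) Bot)"
    then show "prov T k \<alpha> (inst xs \<phi>) \<and> prov T k \<alpha> (inst ys \<psi>)"
      using w\<phi> w by (auto intro!: bot fm_in_inst simp: inst_Bot)
  next
    fix k \<alpha> and xs :: "'f tm list"
    assume *: "length xs = n" "tms_in S k xs" "prov T k \<alpha> (inst xs \<phi>)"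
    have "prov T k \<alpha> (inst xs Bot)"
      using * empty by (blast intro: cut sub_inst)
    then show "prov T k \<alpha> (Exs m (inst (weaken_tms m xs @ vars 0 m) Bot))"
      by (auto intro!: bot simp: inst_def)
  next
    fix k \<alpha> and xs ys zs :: "'f tm list"
    assume "length ys = m" "length zs = m" "tms_in S k ys" "tms_in S k zs"
      "prov T k \<alpha> (inst (xs @ ys) Bot)"
    then show "\<forall>i<m. prov T k \<alpha> (Eq (ys ! i) (zs ! i))"
      by (auto intro!: bot simp: inst_def)
  }
qed

lemma (in wf_geometric_theory) class_eqD:
  assumes "prov_class T n \<theta> = prov_class T n \<theta>'" "fm_in S n \<theta>'"
  shows "prov T n \<theta> \<theta>'"
  using assms ident[of T n \<theta>'] unfolding prov_class_def prov_equiv_def by blast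

text \<open>
  The points are the two closed terms, as arrows from the terminal object \<open>{[]. \<top>}\<close> to
  \<open>{x. \<top>}\<close>. If their composites with an arrow out of \<open>{x. \<phi>}\<close> agree, then
  \<open>\<phi>\<close> proves \<open>s = t\<close>, hence falsity, and falsity is a functional formula from
  \<open>\<phi>\<close> to any target.
\<close>

lemma (in wf_geometric_theory) has_disjoint_points_closed_terms:
  assumes s: "tm_in S 0 s" and t: "tm_in S 0 t" and st: "prov T 0 (Eq s t) Bot"
  shows "has_disjoint_points \<S>"
proof -
  let ?X = "(0, Top) :: nat \<times> ('f, 'r, 'i) fm" and ?A = "(1, Top) :: nat \<times> ('f, 'r, 'i) fm"
  let ?pt = "\<lambda>s. Eq (Var 0) s :: ('f, 'r, 'i) fm"
  note F = functional_closed_term[OF s] and G = functional_closed_term[OF t]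
  have w: "fm_in S (0 + 1) (?pt s)" "fm_in S (0 + 1) (?pt t)"
    using tm_in_closed[OF s] tm_in_closed[OF t] by simp_all
  have empty: "prov T n \<phi> Bot"
    if w\<phi>: "fm_in S n \<phi>" and e: "functional n \<phi> 0 Top \<theta>"
      and eq: "Cmp \<S> (n, \<phi>) ?X ?A (prov_class T (0 + 1) (?pt s)) (prov_class T (n + 0) \<theta>) =
        Cmp \<S> (n, \<phi>) ?X ?A (prov_class T (0 + 1) (?pt t)) (prov_class T (n + 0) \<theta>)"
    for n \<phi> \<theta>
  proof -
    let ?xs = "vars 0 n :: 'f tm list"
    have w\<theta>: "fm_in S (n + 0) \<theta>" using F_wf[OF e w\<phi>] by simp
    have st_comp: "prov T (n + 1) (comp_fm n 0 1 (?pt s) \<theta>) (comp_fm n 0 1 (?pt t) \<theta>)"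
      using eq unfolding Cmp_class[OF w\<theta> w(1)] Cmp_class[OF w\<theta> w(2)]
      by (rule class_eqD) (rule fm_in_comp_fm[OF w\<theta> w(2)])
    have "prov T n \<phi> (inst (?xs @ []) \<theta>)"
      using F_tot[OF e w\<phi>, of ?xs n \<phi>] w\<phi>
      by (simp add: weaken_tms_0 inst_id[of S] ident)
    then have "prov T n \<phi> (inst (?xs @ [s]) (comp_fm n 0 1 (?pt s) \<theta>))"
      using tm_in_closed[OF s] Eq_refl[OF w\<phi> tm_in_closed[OF s]]
      by (intro comp_I[OF w\<theta> w(1), of _ "[]"])
        (simp_all add: tms_in_def[of _ _ "[s]"] inst_Eq_closed[OF s])
    moreover have "prov T n (inst (?xs @ [s]) (comp_fm n 0 1 (?pt s) \<theta>))
        (inst (?xs @ [s]) (comp_fm n 0 1 (?pt t) \<theta>))"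
      using st_comp tm_in_closed[OF s] by (intro sub_inst) (simp_all add: tms_in_def[of _ _ "[s]"])
    ultimately have t_comp: "prov T n \<phi> (inst (?xs @ [s]) (comp_fm n 0 1 (?pt t) \<theta>))"
      by (rule cut)
    have "prov T n \<phi> (Eq s t)"
      by (rule comp_E[OF w\<theta> w(2) _ _ _ _ t_comp])
        (use tm_in_closed[OF s] tm_in_closed[OF t] in
          \<open>simp_all add: tms_in_def[of _ _ "[s]"] weaken_tms_0 inst_Eq_closed[OF t]\<close>)
    moreover have "prov T n (Eq s t) Bot"
      using subst_rule[OF st, of n Var] by (simp add: tm_subst_Var)
    ultimately show ?thesis by (rule cut)
  qed
  show ?thesis unfolding has_disjoint_points_def
  proof (rule bexI[of _ ?X], rule bexI[of _ ?A], rule bexI[of _ "prov_class T (0 + 1) (?pt s)"],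
      rule bexI[of _ "prov_class T (0 + 1) (?pt t)"], intro conjI ballI impI)
    show "?X \<in> Obj \<S>" "?A \<in> Obj \<S>" by (simp_all add: Obj_iff)
    show "prov_class T (0 + 1) (?pt s) \<in> Hom \<S> ?X ?A" by (rule Hom_I[OF F])
    show "prov_class T (0 + 1) (?pt t) \<in> Hom \<S> ?X ?A" by (rule Hom_I[OF G])
  next
    fix B assume "B \<in> Obj \<S>"
    then show "Hom \<S> B ?X \<noteq> {}"
      using Hom_I[OF functional_to_terminal] by (cases B) (auto simp: Obj_iff)
  next
    fix E e B assume E: "E \<in> Obj \<S>" and e: "e \<in> Hom \<S> E ?X" and B: "B \<in> Obj \<S>"
      and eq: "Cmp \<S> E ?X ?A (prov_class T (0 + 1) (?pt s)) e =
        Cmp \<S> E ?X ?A (prov_class T (0 + 1) (?pt t)) e"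
    obtain n \<phi> m \<psi> where EB: "E = (n, \<phi>)" "B = (m, \<psi>)" by (cases E, cases B)
    obtain \<theta> where th: "functional n \<phi> 0 Top \<theta>" "e = prov_class T (n + 0) \<theta>"
      using Hom_E e EB by metis
    have "prov T n \<phi> Bot" using empty[OF _ th(1)] E eq EB th(2) by (simp add: Obj_iff)
    then show "Hom \<S> E B \<noteq> {}"
      using Hom_I[OF functional_from_empty, of n \<phi> m \<psi>] B EB by (auto simp: Obj_iff)
  qed
qed


section \<open>Theories with a one-element model\<close>

text \<open>
  In a structure with exactly one element there is a single assignment of the variables and any two
  terms are equal, so truth depends only on which relation symbols hold of the only tuple; \<open>R\<close>
  records them.
\<close>

primrec holds_singleton :: "('r \<Rightarrow> bool) \<Rightarrow> ('f, 'r, 'i) fm \<Rightarrow> bool" where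
  "holds_singleton R (Eq s t) \<longleftrightarrow> True"
| "holds_singleton R (Rel r ts) \<longleftrightarrow> R r"
| "holds_singleton R Top \<longleftrightarrow> True"
| "holds_singleton R (And \<phi> \<psi>) \<longleftrightarrow> holds_singleton R \<phi> \<and> holds_singleton R \<psi>"
| "holds_singleton R Bot \<longleftrightarrow> False"
| "holds_singleton R (Or \<phi> \<psi>) \<longleftrightarrow> holds_singleton R \<phi> \<or> holds_singleton R \<psi>"
| "holds_singleton R (Disj A F) \<longleftrightarrow> (\<exists>i\<in>A. holds_singleton R (F i))"
| "holds_singleton R (Ex \<phi>) \<longleftrightarrow> holds_singleton R \<phi>"

lemma holds_singleton_subst [simp]: "holds_singleton R (subst \<sigma> \<phi>) \<longleftrightarrow> holds_singleton R \<phi>"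
  by (induction \<phi> arbitrary: \<sigma>) auto

lemma holds_singleton_inst [simp]: "holds_singleton R (inst ts \<phi>) \<longleftrightarrow> holds_singleton R \<phi>"
  by (simp add: inst_def)

lemma holds_singleton_Exs [simp]: "holds_singleton R (Exs m \<phi>) \<longleftrightarrow> holds_singleton R \<phi>"
  by (induction m) simp_all

definition singleton_model :: "('r \<Rightarrow> bool) \<Rightarrow> ('f, 'r, 'i) gtheory \<Rightarrow> bool" where
  "singleton_model R T \<longleftrightarrow>
    (\<forall>(n, \<phi>, \<psi>) \<in> axs T. holds_singleton R \<phi> \<longrightarrow> holds_singleton R \<psi>)"

lemma singleton_model_sound:
  assumes "prov T n \<phi> \<psi>" "singleton_model R T" "holds_singleton R \<phi>"
  shows "holds_singleton R \<psi>"
  using assms by (induction rule: prov.induct) (auto simp: singleton_model_def)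

text \<open>
  The projection \<open>(x, y) \<mapsto> x\<close> from \<open>{x, y. \<theta>(x, y) \<and> \<gamma>(x, y)}\<close>, whose
  domain says that \<open>y\<close> is the common value of \<open>\<theta>\<close> and \<open>\<gamma>\<close> at
  \<open>x\<close>.
\<close>

definition agreement_proj ::
    "nat \<Rightarrow> nat \<Rightarrow> ('f, 'r, 'i) fm \<Rightarrow> ('f, 'r, 'i) fm \<Rightarrow> ('f, 'r, 'i) fm" where
  "agreement_proj n m \<theta> \<gamma> =
    And (inst (vars 0 (n + m)) (And \<theta> \<gamma>)) (Eqs (vars 0 n) (vars (n + m) n))"

context wf_geometric_theory
begin

context
  fixes n m \<phi> \<psi> \<theta> \<gamma>
  assumes w: "fm_in S n \<phi>" "fm_in S m \<psi>"
    and F: "functional n \<phi> m \<psi> \<theta>" and G: "functional n \<phi> m \<psi> \<gamma>"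
begin

lemma fm_in_agreement_proj: "fm_in S (n + m + n) (agreement_proj n m \<theta> \<gamma>)"
  using F_wf[OF F w] F_wf[OF G w]
  by (auto simp: agreement_proj_def intro!: fm_in_inst fm_in_Eqs)

lemma agreement_proj_iff:
  assumes l: "length xs = n" "length ys = m" "length zs = n"
  shows "prov T k \<alpha> (inst ((xs @ ys) @ zs) (agreement_proj n m \<theta> \<gamma>)) \<longleftrightarrow>
    prov T k \<alpha> (inst (xs @ ys) \<theta>) \<and> prov T k \<alpha> (inst (xs @ ys) \<gamma>) \<and>
    (\<forall>i<n. prov T k \<alpha> (Eq (xs ! i) (zs ! i)))"
proof -
  have "inst ((xs @ ys) @ zs) (agreement_proj n m \<theta> \<gamma>) =
      And (inst ((xs @ ys) @ zs) (inst (vars 0 (n + m)) (And \<theta> \<gamma>)))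
        (inst ((xs @ ys) @ zs) (Eqs (vars 0 n) (vars (n + m) n)))"
    by (simp add: agreement_proj_def inst_def)
  also have "inst ((xs @ ys) @ zs) (inst (vars 0 (n + m)) (And \<theta> \<gamma>)) = inst (xs @ ys) (And \<theta> \<gamma>)"
    using l F_wf[OF F w] F_wf[OF G w] by (simp add: inst_inst[of S] map_isub_vars)
  also have "\<dots> = And (inst (xs @ ys) \<theta>) (inst (xs @ ys) \<gamma>)" by (simp add: inst_def)
  also have "inst ((xs @ ys) @ zs) (Eqs (vars 0 n) (vars (n + m) n)) = Eqs xs zs"
    using l by (simp add: inst_isub subst_Eqs map_isub_vars)
  finally have e: "inst ((xs @ ys) @ zs) (agreement_proj n m \<theta> \<gamma>) =
      And (And (inst (xs @ ys) \<theta>) (inst (xs @ ys) \<gamma>)) (Eqs xs zs)" .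
  have l': "length xs = length zs" using l by simp
  show ?thesis unfolding e
    using Eqs_iff[OF wfL l', of k \<alpha>] l
    by (auto intro!: and_I dest: andD1 andD2)
qed

lemma agreement_proj_functional:
  "functional (n + m) (And \<theta> \<gamma>) n \<phi> (agreement_proj n m \<theta> \<gamma>)"
proof (rule functional_I)
  show "fm_in S (n + m) (And \<theta> \<gamma>)" using F_wf[OF F w] F_wf[OF G w] by simp
  have split: "\<exists>xs ys. us = xs @ ys \<and> length xs = n \<and> length ys = m"
    if "length us = n + m" for us :: "'f tm list"
    using that by (intro exI[of _ "take n us"] exI[of _ "drop n us"]) simp
  {
    fix k \<alpha> and us zs :: "'f tm list"
    assume *: "length us = n + m" "length zs = n" "tms_in S k us" "tms_in S k zs"
      "prov T k \<alpha> (inst (us @ zs) (agreement_proj n m \<theta> \<gamma>))"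
    obtain xs ys where us: "us = xs @ ys" "length xs = n" "length ys = m" using split *(1) by blast
    have a: "prov T k \<alpha> (inst us \<theta>)" "prov T k \<alpha> (inst us \<gamma>)"
      "\<forall>i<n. prov T k \<alpha> (Eq (xs ! i) (zs ! i))"
      using *(5) agreement_proj_iff[OF us(2,3) *(2)] us(1) by simp_all
    have "prov T k \<alpha> (inst xs \<phi>)"
      using F_dom(1)[OF F w us(2,3)] a(1) *(3) us(1) by simp
    then have "prov T k \<alpha> (inst zs \<phi>)"
      using a(3) w us * by (intro Leibs[of xs \<phi> zs]) simp_all
    then show "prov T k \<alpha> (inst us (And \<theta> \<gamma>)) \<and> prov T k \<alpha> (inst zs \<phi>)"
      using and_I[OF a(1,2)] by (simp add: inst_def)
  next
    fix k \<alpha> and us :: "'f tm list"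
    assume *: "length us = n + m" "tms_in S k us" "prov T k \<alpha> (inst us (And \<theta> \<gamma>))"
    obtain xs ys where us: "us = xs @ ys" "length xs = n" "length ys = m" using split *(1) by blast
    have "prov T k \<alpha> (And (inst us \<theta>) (inst us \<gamma>))" using *(3) by (simp add: inst_def)
    then have "prov T k \<alpha> (inst (us @ xs) (agreement_proj n m \<theta> \<gamma>))"
      using agreement_proj_iff[OF us(2,3,2)] us *(2) wfL[OF *(3)]
      by (auto intro!: Eq_refl dest: andD1 andD2)
    then show "prov T k \<alpha> (Exs n (inst (weaken_tms n us @ vars 0 n) (agreement_proj n m \<theta> \<gamma>)))"
      using us * fm_in_agreement_proj by (intro tot_R[where ys = xs]) simp_all
  next
    fix k \<alpha> and us zs zs' :: "'f tm list"
    assume *: "length us = n + m" "length zs = n" "length zs' = n"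
      "prov T k \<alpha> (inst (us @ zs) (agreement_proj n m \<theta> \<gamma>))"
      "prov T k \<alpha> (inst (us @ zs') (agreement_proj n m \<theta> \<gamma>))"
    obtain xs ys where us: "us = xs @ ys" "length xs = n" "length ys = m" using split *(1) by blast
    show "\<forall>i<n. prov T k \<alpha> (Eq (zs ! i) (zs' ! i))"
      using *(4,5) agreement_proj_iff[OF us(2,3) *(2)] agreement_proj_iff[OF us(2,3) *(3)] us(1)
      by (auto intro: Eq_trans[OF Eq_sym])
  }
qed (use fm_in_agreement_proj w in simp_all)

text \<open>On the agreement locus both composites send \<open>(x, y)\<close> to \<open>y\<close>.\<close>

lemma agreement_proj_equalizes:
  "prov T (n + m + m) (comp_fm (n + m) n m \<theta> (agreement_proj n m \<theta> \<gamma>))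
    (comp_fm (n + m) n m \<gamma> (agreement_proj n m \<theta> \<gamma>))"
proof -
  let ?e = "agreement_proj n m \<theta> \<gamma>"
  note we = fm_in_agreement_proj and w\<theta> = F_wf[OF F w] and w\<gamma> = F_wf[OF G w]
  note wc = fm_in_comp_fm[OF we w\<theta>] and wd = fm_in_comp_fm[OF we w\<gamma>]
  show ?thesis
  proof (rule equiv_I[OF wc wd])
    fix k \<alpha> and us zs :: "'f tm list"
    assume *: "length us = n + m" "length zs = m" "tms_in S k us" "tms_in S k zs"
      "prov T k \<alpha> (inst (us @ zs) (comp_fm (n + m) n m \<theta> ?e))"
    define xs ys where "xs = take n us" and "ys = drop n us"
    have us: "us = xs @ ys" "length xs = n" "length ys = m" using *(1) by (simp_all add: xs_def ys_def)
    have in0: "tms_in S k xs" "tms_in S k ys" using *(3) us(1) by simp_all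
    show "prov T k \<alpha> (inst (us @ zs) (comp_fm (n + m) n m \<gamma> ?e))"
    proof (rule comp_E[OF we w\<theta> *])
      show "fm_in S k (inst (us @ zs) (comp_fm (n + m) n m \<gamma> ?e))"
        using wd * by (simp add: fm_in_inst)
      fix \<beta>
      let ?xs = "weaken_tms n xs" and ?ys = "weaken_tms n ys" and ?zs = "weaken_tms n zs"
      assume b: "prov T (n + k) \<beta> (inst (weaken_tms n us @ vars 0 n) ?e)"
        "prov T (n + k) \<beta> (inst (vars 0 n @ ?zs) \<theta>)"
      have l: "length ?xs = n" "length ?ys = m" "length ?zs = m" using us * by simp_all
      have in1: "tms_in S (n + k) ?xs" "tms_in S (n + k) ?ys" "tms_in S (n + k) ?zs"
        "tms_in S (n + k) (vars 0 n)" using in0 * by simp_all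
      have a: "prov T (n + k) \<beta> (inst (?xs @ ?ys) \<theta>)" "prov T (n + k) \<beta> (inst (?xs @ ?ys) \<gamma>)"
        "\<forall>i<n. prov T (n + k) \<beta> (Eq (?xs ! i) (vars 0 n ! i))"
        using b(1) agreement_proj_iff[OF l(1,2) length_vars] us(1) by simp_all
      have move: "prov T (n + k) \<beta> (inst (vars 0 n @ ?ys) \<delta>)"
        if "prov T (n + k) \<beta> (inst (?xs @ ?ys) \<delta>)" "fm_in S (n + m) \<delta>" for \<delta>
      proof (rule Leibs[OF _ _ _ _ _ that(1)])
        show "\<forall>i<length (?xs @ ?ys).
            prov T (n + k) \<beta> (Eq ((?xs @ ?ys) ! i) ((vars 0 n @ ?ys) ! i))"
        proof (intro allI impI)
          fix i assume "i < length (?xs @ ?ys)"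
          then show "prov T (n + k) \<beta> (Eq ((?xs @ ?ys) ! i) ((vars 0 n @ ?ys) ! i))"
            using a(3) l in1 Eq_refl[OF wfL[OF a(1)]]
            by (cases "i < n") (simp_all add: nth_append del: nth_vars length_U)
        qed
      qed (use that l in1 in simp_all)
      have eq: "\<forall>i<m. prov T (n + k) \<beta> (Eq (?ys ! i) (?zs ! i))"
        using F_uniq[OF F w length_vars l(2,3) in1(4,2,3) move[OF a(1) w\<theta>] b(2)] .
      have "prov T (n + k) \<beta> (inst (vars 0 n @ ?zs) \<gamma>)"
      proof (rule Leibs[OF _ _ _ _ _ move[OF a(2) w\<gamma>]])
        show "\<forall>i<length (vars 0 n @ ?ys).
            prov T (n + k) \<beta> (Eq ((vars 0 n @ ?ys) ! i) ((vars 0 n @ ?zs) ! i))"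
        proof (intro allI impI)
          fix i assume "i < length (vars 0 n @ ?ys)"
          then show "prov T (n + k) \<beta> (Eq ((vars 0 n @ ?ys) ! i) ((vars 0 n @ ?zs) ! i))"
            using eq l in1 Eq_refl[OF wfL[OF a(1)]]
            by (cases "i < n") (simp_all add: nth_append del: length_U)
        qed
      qed (use w\<gamma> l in1 in simp_all)
      then have "prov T (n + k) \<beta> (inst (weaken_tms n us @ ?zs) (comp_fm (n + m) n m \<gamma> ?e))"
        using in1 l * us(1) b(1) by (intro comp_I[OF we w\<gamma>, of _ "vars 0 n"]) simp_all
      then show "prov T (n + k) \<beta> (weaken n (inst (us @ zs) (comp_fm (n + m) n m \<gamma> ?e)))"
        using wd * by (simp add: up_inst)
    qed
  qed
qed

end

lemma agreement_proj_commute: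
  assumes w: "fm_in S n \<phi>" "fm_in S m \<psi>"
    and F: "functional n \<phi> m \<psi> \<theta>" and G: "functional n \<phi> m \<psi> \<gamma>"
  shows "prov T (n + m + n) (agreement_proj n m \<theta> \<gamma>) (agreement_proj n m \<gamma> \<theta>)"
proof (rule equiv_I)
  fix k \<alpha> and us zs :: "'f tm list"
  assume *: "length us = n + m" "length zs = n"
    "prov T k \<alpha> (inst (us @ zs) (agreement_proj n m \<theta> \<gamma>))"
  then have us: "us = take n us @ drop n us" "length (take n us) = n" "length (drop n us) = m"
    by simp_all
  show "prov T k \<alpha> (inst (us @ zs) (agreement_proj n m \<gamma> \<theta>))"
    using *(3) agreement_proj_iff[OF w F G us(2,3) *(2)] agreement_proj_iff[OF w G F us(2,3) *(2)]
      us(1) by simp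
qed (rule fm_in_agreement_proj[OF w F G] fm_in_agreement_proj[OF w G F])+

lemma agreement_proj_Cmp:
  assumes w: "fm_in S n \<phi>" "fm_in S m \<psi>"
    and F: "functional n \<phi> m \<psi> \<theta>" and G: "functional n \<phi> m \<psi> \<gamma>"
  defines "e \<equiv> prov_class T (n + m + n) (agreement_proj n m \<theta> \<gamma>)"
  shows "Cmp \<S> (n + m, And \<theta> \<gamma>) (n, \<phi>) (m, \<psi>) (prov_class T (n + m) \<theta>) e =
    Cmp \<S> (n + m, And \<theta> \<gamma>) (n, \<phi>) (m, \<psi>) (prov_class T (n + m) \<gamma>) e"
proof -
  let ?e = "agreement_proj n m \<theta> \<gamma>" and ?e' = "agreement_proj n m \<gamma> \<theta>"
  note we = fm_in_agreement_proj[OF w F G] and we' = fm_in_agreement_proj[OF w G F]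
  note w\<theta> = F_wf[OF F w] and w\<gamma> = F_wf[OF G w]
  \<comment> \<open>The converse of \<open>agreement_proj_equalizes\<close> is that lemma with \<open>\<theta>\<close> and \<open>\<gamma>\<close> exchanged.\<close>
  have "prov T (n + m + m) (comp_fm (n + m) n m \<gamma> ?e) (comp_fm (n + m) n m \<theta> ?e)"
    using cut[OF cut[OF comp_cong1[OF we w\<gamma> agreement_proj_commute[OF w F G] ident[OF w\<gamma>]]
        agreement_proj_equalizes[OF w G F]]
      comp_cong1[OF we' w\<theta> agreement_proj_commute[OF w G F] ident[OF w\<theta>]]] .
  then show ?thesis
    unfolding e_def Cmp_class[OF we w\<theta>] Cmp_class[OF we w\<gamma>]
    using agreement_proj_equalizes[OF w F G] by (intro prov_class_eq) (simp add: prov_equiv_def)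
qed

text \<open>
  An arrow from \<open>{[]. \<top>}\<close> makes \<open>X\<close> true in the model, so the two values at its
  point exist and coincide. The agreement locus is then true in the model and cannot have an arrow
  to \<open>{[]. \<bottom>}\<close>.
\<close>

lemma no_disjoint_points_singleton_model:
  assumes M: "singleton_model R T"
  shows "\<not> has_disjoint_points \<S>"
proof
  note sound = singleton_model_sound[OF _ M]
  assume "has_disjoint_points \<S>"
  then obtain X A f g where X: "X \<in> Obj \<S>" and A: "A \<in> Obj \<S>"
    and f: "f \<in> Hom \<S> X A" and g: "g \<in> Hom \<S> X A"
    and to_X: "\<And>B. B \<in> Obj \<S> \<Longrightarrow> Hom \<S> B X \<noteq> {}"
    and disj: "\<And>E e B. E \<in> Obj \<S> \<Longrightarrow> e \<in> Hom \<S> E X \<Longrightarrow>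
      Cmp \<S> E X A f e = Cmp \<S> E X A g e \<Longrightarrow> B \<in> Obj \<S> \<Longrightarrow> Hom \<S> E B \<noteq> {}"
    unfolding has_disjoint_points_def by blast
  obtain n \<phi> m \<psi> where XA: "X = (n, \<phi>)" "A = (m, \<psi>)" by (cases X, cases A)
  have w: "fm_in S n \<phi>" "fm_in S m \<psi>" using X A XA by (simp_all add: Obj_iff)
  obtain \<theta> where F: "functional n \<phi> m \<psi> \<theta>" and fe: "f = prov_class T (n + m) \<theta>"
    using Hom_E[OF f[unfolded XA]] by metis
  obtain \<gamma> where G: "functional n \<phi> m \<psi> \<gamma>" and ge: "g = prov_class T (n + m) \<gamma>"
    using Hom_E[OF g[unfolded XA]] by metis
  have image: "holds_singleton R \<psi>' \<and> holds_singleton R \<theta>'"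
    if "functional n' \<phi>' m' \<psi>' \<theta>'" "holds_singleton R \<phi>'" for n' m' \<phi>' \<psi>' \<theta>'
  proof -
    have "prov T n' \<phi>' (Exs m' (inst (vars m' n' @ vars 0 m') \<theta>'))"
      and "prov T (n' + m') \<theta>' (And (inst (vars 0 n') \<phi>') (inst (vars n' m') \<psi>'))"
      using that(1) by (simp_all add: functional_def prov_functional_def)
    from this[THEN sound] show ?thesis using that(2) by simp
  qed
  obtain t where "t \<in> Hom \<S> (0, Top) (n, \<phi>)" using to_X[of "(0, Top)"] XA by (auto simp: Obj_iff)
  then obtain \<tau> where "functional 0 Top n \<phi> \<tau>" using Hom_E by metis
  then have "holds_singleton R \<phi>" using image by fastforce
  then have true: "holds_singleton R (And \<theta> \<gamma>)" using image[OF F] image[OF G] by simp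
  have "Hom \<S> (n + m, And \<theta> \<gamma>) (0, Bot) \<noteq> {}"
    using disj[of "(n + m, And \<theta> \<gamma>)"] agreement_proj_Cmp[OF w F G]
      Hom_I[OF agreement_proj_functional[OF w F G]] F_wf[OF F w] F_wf[OF G w]
    unfolding XA fe ge by (simp add: Obj_iff)
  then obtain k where "k \<in> Hom \<S> (n + m, And \<theta> \<gamma>) (0, Bot)" by blast
  then obtain \<kappa> where "functional (n + m) (And \<theta> \<gamma>) 0 Bot \<kappa>" using Hom_E by metis
  then show False using image[OF _ true] by fastforce
qed

end


section \<open>The two theories\<close>

lemma Loc2_has_disjoint_points:
  "has_disjoint_points (syntactic_category (Loc2 I J :: (mv_fun, unit, 'i) gtheory))"
proof -
  interpret wf_geometric_theory "Loc2 I J :: (mv_fun, unit, 'i) gtheory"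
    by unfold_locales (rule wf_Loc2)
  show ?thesis
  proof (rule has_disjoint_points_closed_terms)
    show "prov (Loc2 I J :: (mv_fun, unit, 'i) gtheory) 0 (Eq mv_zero mv_one) Bot"
      by (rule ax) (simp add: Loc2_def Let_def)
  qed (simp_all add: Loc2_def T_V_def Let_def mv_one_def)
qed

text \<open>
  All equations hold in the trivial group, and \<open>{1}\<close> is closed under divisors
  and least common multiples. The axioms that make \<open>R\<^sub>k\<close> inconsistent concern only
  \<open>k\<close> outside \<open>\<delta>(I) \<union> \<delta>(J)\<close>, a set that contains \<open>1\<close> because
  \<open>I \<union> J\<close> is nonempty.
\<close>

lemma singleton_model_G_IJ:
  assumes "komori_index I J"
  shows "singleton_model (\<lambda>k. k = 1) (G_IJ I J)"
proof -
  have "1 \<in> delta I \<union> delta J" using assms by (auto simp: komori_index_def delta_def)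
  then show ?thesis
    by (auto simp: singleton_model_def G_IJ_def lgroup_axioms_def rank_axioms_def Let_def)
qed

theorem proposition7p9:
  fixes I J :: "nat set"
  assumes "komori_index I J"
  shows "\<not> bi_interpretable
    (Loc2 I J :: (mv_fun, unit, 'i::infinite) gtheory) (G_IJ I J :: (lg_fun, nat, 'i) gtheory)"
proof
  let ?L = "Loc2 I J :: (mv_fun, unit, 'i) gtheory" and ?G = "G_IJ I J :: (lg_fun, nat, 'i) gtheory"
  interpret L: wf_geometric_theory ?L by unfold_locales (rule wf_Loc2)
  interpret G: wf_geometric_theory ?G by unfold_locales (rule wf_G[OF assms])
  assume "bi_interpretable ?L ?G"
  then have "has_disjoint_points (syntactic_category ?G)"
    unfolding bi_interpretable_def
    by (intro has_disjoint_points_transfer[OF L.syntactic_is_category G.syntactic_is_category]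
      Loc2_has_disjoint_points)
  then show False
    using G.no_disjoint_points_singleton_model[OF singleton_model_G_IJ[OF assms]] by contradiction
qed

end
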